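(* Let $\mu$ be a diagram containing $d$ boxes on the main diagonal. The dual Schur function $\widehat s_\mu(x\|a)$ can be written as the series $$\widehat s_\mu(x\|a)=\sum_\lambda(-1)^{n(\lambda/\mu)}\det\big[h_{\lambda_i-\mu_j-i+j}(a_0,a_{-1},\dots,a_{j-\mu_j})\big]_{i,j=1}^d\;\det\big[e_{\lambda_i-\mu_j-i+j}(a_1,a_2,\dots,a_{j-\mu_j-1})\big]_{i,j=d+1}^{n}\;s_\lambda(x),$$ summed over diagrams $\lambda$ which contain $\mu$ and such that $\lambda$ has $d$ boxes on the main diagonal, where $n=\ell(\lambda)$ in the second determinant and $n(\lambda/\mu)$ denotes the total number of boxes of $\lambda/\mu$ in rows $d+1,d+2,\dots,\ell(\lambda)$.
   Context: Let $a=(a_i)_{i\in\mathbb Z}$ be a sequence of commuting indeterminates and $\mathbb Q[a]$ the polynomial ring in the $a_i$; $x=(x_1,x_2,\dots)$; $\ell(\lambda)$ is the number of nonzero parts of $\lambda$; $s_\lambda(x)$ are the ordinary Schur functions. $h_k(\cdot)$ and $e_k(\cdot)$ are the usual complete and elementary symmetric polynomials in the indicated (possibly empty) finite set of variables, with $h_0=e_0=1$ and $h_k=e_k=0$ for $k<0$; an empty determinant is $1$. Dual Schur functions: let $\widehat\Lambda(x\|a)$ be the ring of formal (possibly infinite) sums $\sum_{\lambda}c_\lambda(a)s_\lambda(x)$, $c_\lambda(a)\in\mathbb Q[a]$. For a partition $\mu$ with $d$ boxes on the main diagonal and $N\geqslant\ell(\mu)$, $$\widehat s_\mu(x_1,\dots,x_N\|a)=\frac{\det[A_{ij}]_{i,j=1}^N}{\prod_{1\leqslant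 i<j\leqslant N}(x_i-x_j)},$$ where $A_{ij}=\dfrac{x_i^{\mu_j+N-j}}{(1-a_0x_i)(1-a_{-1}x_i)\cdots(1-a_{j-\mu_j}x_i)}$ for $1\leqslant j\leqslant d$ and $A_{ij}=x_i^{\mu_j+N-j}(1-a_1x_i)\cdots(1-a_{j-\mu_j-1}x_i)$ for $d<j\leqslant N$; it is $0$ if $\ell(\mu)>N$. These are compatible with setting $x_N=0$ and define $\widehat s_\mu(x\|a)\in\widehat\Lambda(x\|a)$. *)

theory Defs
  imports
    "HOL-Library.Poly_Mapping"
    "HOL-Library.Multiset"
    "Jordan_Normal_Form.Determinant"
begin

text \<open>Formal power series over a commutative ring in variables indexed by an arbitrary
  (possibly infinite) type; a series is the family of its coefficients, indexed by the monomials.\<close>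

typedef ('v, 'a) mps = "UNIV :: (('v \<Rightarrow>\<^sub>0 nat) \<Rightarrow> 'a) set"
  morphisms mps_coeff Abs_mps ..

setup_lifting type_definition_mps

lemma mps_eqI: "(\<And>m. mps_coeff f m = mps_coeff g m) \<Longrightarrow> f = g"
  by (simp add: mps_coeff_inject [symmetric] fun_eq_iff)

definition splits :: "('v \<Rightarrow>\<^sub>0 nat) \<Rightarrow> (('v \<Rightarrow>\<^sub>0 nat) \<times> ('v \<Rightarrow>\<^sub>0 nat)) set" where
  "splits m = {(p, q). p + q = m}"

lemma finite_splits: "finite (splits m)"
proof -
  define B where "B = Max (insert 0 (Poly_Mapping.range m))"
  define F where "F = {f. \<forall>v. (v \<in> Poly_Mapping.keys m \<longrightarrow> f v \<in> {..B}) \<and>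
                              (v \<notin> Poly_Mapping.keys m \<longrightarrow> f v = (0::nat))}"
  define D where "D = {p. Poly_Mapping.lookup p \<in> F}"
  have "finite F"
    unfolding F_def by (rule finite_set_of_finite_funs) simp_all
  then have "finite (Poly_Mapping.lookup -` F)"
    by (rule finite_vimageI) (simp add: inj_on_def lookup_inject)
  then have finD: "finite D"
    by (simp add: D_def vimage_def)
  have bounded: "p \<in> D" if "p + q = m" for p q
  proof -
    have le: "Poly_Mapping.lookup p v \<le> Poly_Mapping.lookup m v" for v
      by (simp add: that [symmetric] lookup_add)
    have "Poly_Mapping.lookup p v \<le> B" if "v \<in> Poly_Mapping.keys m" for v
    proof -
      have "Poly_Mapping.lookup m v \<le> B"
        unfolding B_def using that by (intro Max_ge) (simp_all add: in_keys_lookup_in_range)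
      with le [of v] show ?thesis by (rule le_trans)
    qed
    moreover have "Poly_Mapping.lookup p v = 0" if "v \<notin> Poly_Mapping.keys m" for v
      using le [of v] that by (simp add: in_keys_iff)
    ultimately show ?thesis by (simp add: D_def F_def)
  qed
  have "splits m \<subseteq> D \<times> D"
  proof
    fix z
    assume "z \<in> splits m"
    then obtain p q where z: "z = (p, q)" and pq: "p + q = m"
      by (auto simp: splits_def)
    from pq have "q + p = m" by (simp add: add.commute)
    with pq show "z \<in> D \<times> D"
      unfolding z using bounded by simp
  qed
  then show ?thesis
    by (rule finite_subset) (intro finite_cartesian_product finD)
qed

instantiation mps :: (type, comm_ring_1) comm_ring_1
begin

lift_definition zero_mps :: "('a, 'b) mps" is "\<lambda>_. 0" .
lift_definition one_mps :: "('a, 'b) mps" is "\<lambda>m. if m = 0 then 1 else 0" .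
lift_definition plus_mps :: "('a, 'b) mps \<Rightarrow> ('a, 'b) mps \<Rightarrow> ('a, 'b) mps"
  is "\<lambda>f g m. f m + g m" .
lift_definition minus_mps :: "('a, 'b) mps \<Rightarrow> ('a, 'b) mps \<Rightarrow> ('a, 'b) mps"
  is "\<lambda>f g m. f m - g m" .
lift_definition uminus_mps :: "('a, 'b) mps \<Rightarrow> ('a, 'b) mps"
  is "\<lambda>f m. - f m" .
lift_definition times_mps :: "('a, 'b) mps \<Rightarrow> ('a, 'b) mps \<Rightarrow> ('a, 'b) mps"
  is "\<lambda>f g m. \<Sum>(p, q)\<in>splits m. f p * g q" .

instance
proof
  fix f g h :: "('a, 'b) mps"
  show "f * g * h = f * (g * h)"
  proof (rule mps_eqI)
    fix m
    have "mps_coeff (f * g * h) m =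
        (\<Sum>x\<in>splits m. \<Sum>y\<in>splits (fst x).
          mps_coeff f (fst y) * mps_coeff g (snd y) * mps_coeff h (snd x))"
      by (simp add: times_mps.rep_eq case_prod_beta sum_distrib_right)
    also have "\<dots> = (\<Sum>(x, y)\<in>Sigma (splits m) (\<lambda>x. splits (fst x)).
          mps_coeff f (fst y) * mps_coeff g (snd y) * mps_coeff h (snd x))"
      by (rule sum.Sigma) (auto simp: finite_splits)
    also have "\<dots> = (\<Sum>(x, y)\<in>Sigma (splits m) (\<lambda>x. splits (snd x)).
          mps_coeff f (fst x) * (mps_coeff g (fst y) * mps_coeff h (snd y)))"
      by (rule sum.reindex_bij_witness
          [of _ "\<lambda>((p, q), (r, s)). ((p + r, s), (p, r))" "\<lambda>((p, q), (r, s)). ((r, s + q), (s, q))"])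
        (auto simp: splits_def algebra_simps)
    also have "\<dots> = (\<Sum>x\<in>splits m. \<Sum>y\<in>splits (snd x).
          mps_coeff f (fst x) * (mps_coeff g (fst y) * mps_coeff h (snd y)))"
      by (rule sum.Sigma [symmetric]) (auto simp: finite_splits)
    also have "\<dots> = mps_coeff (f * (g * h)) m"
      by (simp add: times_mps.rep_eq case_prod_beta sum_distrib_left)
    finally show "mps_coeff (f * g * h) m = mps_coeff (f * (g * h)) m" .
  qed
  show "f * g = g * f"
  proof (rule mps_eqI)
    fix m
    show "mps_coeff (f * g) m = mps_coeff (g * f) m"
      unfolding times_mps.rep_eq
      by (rule sum.reindex_bij_witness [of _ prod.swap prod.swap])
        (auto simp: splits_def algebra_simps)
  qed
  show "1 * f = f"
  proof (rule mps_eqI)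
    fix m
    have "mps_coeff (1 * f) m =
        (\<Sum>(p, q)\<in>{(0 :: 'a \<Rightarrow>\<^sub>0 nat, m)}. (if p = 0 then 1 else 0) * mps_coeff f q)"
      unfolding times_mps.rep_eq one_mps.rep_eq
    proof (rule sum.mono_neutral_right)
      show "finite (splits m)" by (rule finite_splits)
      show "{(0, m)} \<subseteq> splits m" by (simp add: splits_def)
      show "\<forall>z\<in>splits m - {(0, m)}. (case z of (p, q) \<Rightarrow> (if p = 0 then 1 else 0) * mps_coeff f q) = 0"
        by (auto simp: splits_def split: if_splits)
    qed
    then show "mps_coeff (1 * f) m = mps_coeff f m" by simp
  qed
  show "(f + g) * h = f * h + g * h"
    by (rule mps_eqI)
      (simp add: times_mps.rep_eq plus_mps.rep_eq case_prod_beta sum.distrib distrib_right)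
  show "f + g + h = f + (g + h)" by transfer (simp add: fun_eq_iff add.assoc)
  show "f + g = g + f" by transfer (simp add: fun_eq_iff add.commute)
  show "0 + f = f" by transfer simp
  show "- f + f = 0" by transfer simp
  show "f - g = f + - g" by transfer (simp add: fun_eq_iff)
  show "(0 :: ('a, 'b) mps) \<noteq> 1"
    by (auto simp: zero_mps.rep_eq one_mps.rep_eq dest: arg_cong [where f = "\<lambda>g. mps_coeff g 0"])
qed

end

lift_definition mps_const :: "'a \<Rightarrow> ('v, 'a::comm_ring_1) mps" is
  "\<lambda>c m. if m = 0 then c else 0" .

lift_definition mps_var :: "'v \<Rightarrow> ('v, 'a::comm_ring_1) mps" is
  "\<lambda>v m. if m = Poly_Mapping.single v 1 then 1 else 0" .

text \<open>Formal infinite sums are taken coefficientwise, every coefficient receiving only finitely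
  many nonzero contributions.\<close>

definition mps_has_sum ::
  "('i \<Rightarrow> ('v, 'a::comm_ring_1) mps) \<Rightarrow> 'i set \<Rightarrow> ('v, 'a) mps \<Rightarrow> bool" where
  "mps_has_sum f I g \<longleftrightarrow> (\<forall>m.
     finite {i \<in> I. mps_coeff (f i) m \<noteq> 0} \<and>
     mps_coeff g m = (\<Sum>i | i \<in> I \<and> mps_coeff (f i) m \<noteq> 0. mps_coeff (f i) m))"

text \<open>The exact quotient $f/g$; meaningful when $g$ is not a zero divisor and divides $f$.\<close>

definition exact_quot :: "'a::comm_ring_1 \<Rightarrow> 'a \<Rightarrow> 'a" where
  "exact_quot f g = (THE q. q * g = f)"

text \<open>The determinant of the matrix $[A_{ij}]$ with $p \le i, j \le q$; it is $1$ for $q = p - 1$.\<close>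

definition block_det :: "nat \<Rightarrow> nat \<Rightarrow> (nat \<Rightarrow> nat \<Rightarrow> 'a::comm_ring_1) \<Rightarrow> 'a" where
  "block_det p q A = det (mat (q + 1 - p) (q + 1 - p) (\<lambda>(i, j). A (i + p) (j + p)))"


text \<open>The polynomial ring $\mathbb{Q}[a]$ in the indeterminates $a_i$, $i \in \mathbb{Z}$.\<close>

type_synonym Qa = "(int \<Rightarrow>\<^sub>0 nat) \<Rightarrow>\<^sub>0 rat"

definition avar :: "int \<Rightarrow> Qa" where
  "avar i = Poly_Mapping.single (Poly_Mapping.single i 1) 1"

text \<open>Complete and elementary symmetric polynomials in the variables $a_t$, $t \in S$.\<close>

definition hsym :: "int \<Rightarrow> int set \<Rightarrow> Qa" where
  "hsym k S = (\<Sum>M | set_mset M \<subseteq> S \<and> int (size M) = k. \<Prod>t\<in>#M. avar t)"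

definition esym :: "int \<Rightarrow> int set \<Rightarrow> Qa" where
  "esym k S = (\<Sum>T | T \<subseteq> S \<and> int (card T) = k. \<Prod>t\<in>T. avar t)"


text \<open>A partition is the list of its nonzero parts, so that $\ell(\lambda)$ is the length of the
  list. Parts are numbered from $1$, and $\lambda_i = 0$ for $i > \ell(\lambda)$.\<close>

definition is_partition :: "nat list \<Rightarrow> bool" where
  "is_partition l \<longleftrightarrow> sorted_wrt (\<ge>) l \<and> 0 \<notin> set l"

definition part :: "nat list \<Rightarrow> nat \<Rightarrow> nat" where
  "part l i = (if 1 \<le> i \<and> i \<le> length l then l ! (i - 1) else 0)"

definition diagram :: "nat list \<Rightarrow> (nat \<times> nat) set" where
  "diagram l = {(i, j). 1 \<le> i \<and> 1 \<le> j \<and> j \<le> part l i}"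

definition diag_boxes :: "nat list \<Rightarrow> nat" where
  "diag_boxes l = card {i. (i, i) \<in> diagram l}"


type_synonym series = "(nat, Qa) mps"

text \<open>The variables $x_1, x_2, \ldots$ are numbered from $1$, whereas the index type of the
  power series starts at $0$.\<close>

definition xvar :: "nat \<Rightarrow> series" where
  "xvar i = mps_var (i - 1)"

definition vandermonde :: "nat \<Rightarrow> series" where
  "vandermonde N = (\<Prod>(i, j)\<in>{(i, j). 1 \<le> i \<and> i < j \<and> j \<le> N}. xvar i - xvar j)"

text \<open>Setting $x_{N+1} = x_{N+2} = \cdots = 0$.\<close>

lift_definition set_zero_above :: "nat \<Rightarrow> (nat, 'a::comm_ring_1) mps \<Rightarrow> (nat, 'a) mps" is
  "\<lambda>N f m. if Poly_Mapping.keys m \<subseteq> {..<N} then f m else 0" .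

text \<open>The series in $x_1, x_2, \ldots$ determined by a family of series $F_N$ in $x_1, \ldots, x_N$
  which is compatible with setting the last variable to zero.\<close>

definition stable_limit :: "(nat \<Rightarrow> series) \<Rightarrow> series" where
  "stable_limit F = (THE f. \<forall>N. set_zero_above N f = F N)"

definition schur_fin :: "nat \<Rightarrow> nat list \<Rightarrow> series" where
  "schur_fin N l =
     (if length l \<le> N
      then exact_quot (block_det 1 N (\<lambda>i j. xvar i ^ (part l j + N - j))) (vandermonde N)
      else 0)"

definition schur :: "nat list \<Rightarrow> series" where
  "schur l = stable_limit (\<lambda>N. schur_fin N l)"

definition dual_schur_entry :: "nat \<Rightarrow> nat list \<Rightarrow> nat \<Rightarrow> nat \<Rightarrow> series" where
  "dual_schur_entry N \<mu> i j =
     (if j \<le> diag_boxes \<mu>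
      then exact_quot (xvar i ^ (part \<mu> j + N - j))
             (\<Prod>t\<in>{int j - int (part \<mu> j)..0}. 1 - mps_const (avar t) * xvar i)
      else xvar i ^ (part \<mu> j + N - j) *
             (\<Prod>t\<in>{1..int j - int (part \<mu> j) - 1}. 1 - mps_const (avar t) * xvar i))"

definition dual_schur_fin :: "nat \<Rightarrow> nat list \<Rightarrow> series" where
  "dual_schur_fin N \<mu> =
     (if length \<mu> \<le> N
      then exact_quot (block_det 1 N (dual_schur_entry N \<mu>)) (vandermonde N)
      else 0)"

definition dual_schur :: "nat list \<Rightarrow> series" where
  "dual_schur \<mu> = stable_limit (\<lambda>N. dual_schur_fin N \<mu>)"

text \<open>The number $n(\lambda/\mu)$ of boxes of $\lambda/\mu$ in rows $d + 1, \ldots, \ell(\lambda)$.\<close>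

definition lower_boxes :: "nat \<Rightarrow> nat list \<Rightarrow> nat list \<Rightarrow> nat" where
  "lower_boxes d l \<mu> = card {(r, c) \<in> diagram l - diagram \<mu>. d + 1 \<le> r \<and> r \<le> length l}"

end

(* Let V be the Vandermonde determinant in x_1, ..., x_N.

   Row i of the matrix defining the dual Schur function involves x_i only, and expanding its
   entries in powers of x_i gives as coefficients the h_k and the signed e_k. Hence the coefficient
   of a monomial in det[A_ij] is the determinant of the corresponding coefficients, one taken in
   each row. It vanishes unless the exponents are distinct, and then sorting them shows that
   det[A_ij] is the sum of det[c_j(lambda_i + N - i)] det[x_i^(lambda_j + N - j)] over all
   partitions lambda of length at most N.

   Newton interpolation of y^p at x_N, ..., x_1 factors every alternant as V times a determinant
   of complete symmetric polynomials in x_k, ..., x_N. This gives divisibility by V, stability in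
   N, and homogeneity, which makes the infinite sum over lambda well defined.

   Finally, the matrix [c_j(lambda_i + N - i)] has a zero rectangle that is too large for a nonzero
   determinant, unless lambda contains mu and has the same diagonal length d; in that case it is
   block triangular. *)

theory Submission imports Defs
begin

subsection \<open>Determinants of index blocks\<close>

text \<open>Both \<open>exact_quot\<close> and \<open>stable_limit\<close> are definite
  descriptions, so each needs a candidate and a uniqueness argument. The candidate for
  \<open>dual_schur \<mu>\<close> is the series on the right of the theorem itself: for every
  \<open>N\<close>, its truncation times \<open>V\<close> is shown to be the determinant defining
  \<open>dual_schur_fin N \<mu>\<close>. Compatibility of the dual Schur functions in
  \<open>N\<close> is thereby inherited from the ordinary ones. The condition on diagonals comes
  from counting variables. The polynomial \<open>e_k\<close> in column \<open>j\<close> has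
  \<open>j - \<mu>_j - 1\<close> variables, which is less than its index
  \<open>\<lambda>_i - \<mu>_j - i + j\<close> exactly when \<open>\<lambda>_i \<ge> i\<close>, that
  is, in the rows that meet the diagonal. At level \<open>N\<close> all determinants have size
  \<open>N\<close> and each \<open>e_k\<close> carries its own sign. To reach the form of the
  theorem, the sign is split into a row factor and a column factor, and the rows beyond the length
  of \<open>\<lambda>\<close> are seen to be zero left of a diagonal entry
  \<open>e_0 = 1\<close>.\<close>

lemma block_det_cong:
  assumes "\<And>i j. p \<le> i \<Longrightarrow> i \<le> q \<Longrightarrow> p \<le> j \<Longrightarrow> j \<le> q \<Longrightarrow> A i j = B i j"
  shows "block_det p q A = block_det p q B"
  unfolding block_det_def using assms by (intro arg_cong [where f = det] eq_matI) auto

lemma block_det_leibniz: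
  "block_det p q A = (\<Sum>\<pi> | \<pi> permutes {0..<q + 1 - p}.
     signof \<pi> * (\<Prod>i = 0..<q + 1 - p. A (i + p) (\<pi> i + p)))"
proof -
  have "\<pi> i < q + 1 - p" if "\<pi> permutes {0..<q + 1 - p}" "i < q + 1 - p" for \<pi> i
    using permutes_in_image [OF that(1), of i] that(2) by simp
  then show ?thesis
    unfolding block_det_def
    by (subst det_def' [where n = "q + 1 - p"]) (auto intro!: sum.cong prod.cong)
qed

lemma prod_shift_block:
  "(\<Prod>i = 0..<Suc q - p. f (i + p)) = (\<Prod>i = p..q. f (i::nat))"
  by (rule prod.reindex_bij_witness [of _ "\<lambda>i. i - p" "\<lambda>i. i + p"]) auto

text \<open>A nonzero Leibniz term would need a permutation mapping \<open>R\<close> injectively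
  into the complement of \<open>C\<close>, which has fewer elements than \<open>R\<close>.\<close>

lemma block_det_zero_rectangle:
  assumes R: "R \<subseteq> {p..q}" and C: "C \<subseteq> {p..q}" and card: "q + 1 - p < card R + card C"
    and zero: "\<And>i j. i \<in> R \<Longrightarrow> j \<in> C \<Longrightarrow> A i j = 0"
  shows "block_det p q A = 0"
proof -
  define R' C' where "R' = (\<lambda>i. i - p) ` R" and "C' = (\<lambda>i. i - p) ` C"
  have cards: "card R' = card R" "card C' = card C"
    unfolding R'_def C'_def using R C by (auto intro!: card_image inj_on_diff_nat)
  have sub: "R' \<subseteq> {0..<q + 1 - p}" "C' \<subseteq> {0..<q + 1 - p}"
    using R C by (fastforce simp: R'_def C'_def)+
  have zero': "A (i + p) (j + p) = 0" if "i \<in> R'" "j \<in> C'" for i j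
    using that R C zero by (auto simp: R'_def C'_def subset_iff)
  have "(\<Prod>i = 0..<q + 1 - p. A (i + p) (\<pi> i + p)) = 0" if \<pi>: "\<pi> permutes {0..<q + 1 - p}" for \<pi>
  proof -
    have "\<pi> ` R' \<inter> C' \<noteq> {}"
    proof
      assume "\<pi> ` R' \<inter> C' = {}"
      moreover have "card (\<pi> ` R') = card R'"
        using \<pi> by (simp add: card_image permutes_inj_on)
      moreover have sub': "\<pi> ` R' \<subseteq> {0..<q + 1 - p}"
        using sub(1) permutes_image [OF \<pi>] by blast
      ultimately have "card (\<pi> ` R' \<union> C') = card R + card C"
        using sub cards by (metis card_Un_disjoint finite_atLeastLessThan finite_subset)
      moreover have "card (\<pi> ` R' \<union> C') \<le> card {0..<q + 1 - p}"
        using sub sub' by (intro card_mono) auto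
      ultimately show False using card by simp
    qed
    then obtain i where "i \<in> R'" "\<pi> i \<in> C'" by auto
    with zero' sub show ?thesis by (auto intro!: prod_zero bexI [of _ i])
  qed
  then show ?thesis by (simp add: block_det_leibniz)
qed

text \<open>In each Leibniz term the column factors are only permuted, so every term acquires the
  same factor. This later extracts the signs of the \<open>e_k\<close>.\<close>

lemma block_det_scale:
  "block_det p q (\<lambda>i j. u i * v j * A i j) = (\<Prod>i = p..q. u i * v i) * block_det p q A"
proof -
  have "(\<Prod>i = 0..<q + 1 - p. u (i + p) * v (\<pi> i + p) * A (i + p) (\<pi> i + p)) =
      (\<Prod>i = p..q. u i * v i) * (\<Prod>i = 0..<q + 1 - p. A (i + p) (\<pi> i + p))"
    if \<pi>: "\<pi> permutes {0..<q + 1 - p}" for \<pi>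
  proof -
    have "(\<Prod>i = 0..<q + 1 - p. v (\<pi> i + p)) = (\<Prod>i = 0..<q + 1 - p. v (i + p))"
      using prod.permute [OF \<pi>, of "\<lambda>i. v (i + p)"] by simp
    then show ?thesis
      by (simp add: prod.distrib prod_shift_block)
  qed
  then show ?thesis
    unfolding block_det_leibniz sum_distrib_left by (auto intro!: sum.cong)
qed

lemma block_det_mult:
  "block_det p q (\<lambda>i j. \<Sum>k = p..q. A i k * B k j) = block_det p q A * block_det p q B"
proof -
  let ?n = "q + 1 - p"
  let ?M = "\<lambda>A. mat ?n ?n (\<lambda>(i, j). A (i + p) (j + p))"
  have "?M (\<lambda>i j. \<Sum>k = p..q. A i k * B k j) = ?M A * ?M B"
  proof (rule eq_matI)
    fix i j assume "i < dim_row (?M A * ?M B)" "j < dim_col (?M A * ?M B)"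
    moreover have "(\<Sum>k = p..q. A (i + p) k * B k (j + p)) =
        (\<Sum>k = 0..<?n. A (i + p) (k + p) * B (k + p) (j + p))"
      by (rule sum.reindex_bij_witness [of _ "\<lambda>k. k + p" "\<lambda>k. k - p"]) auto
    ultimately show "?M (\<lambda>i j. \<Sum>k = p..q. A i k * B k j) $$ (i, j) = (?M A * ?M B) $$ (i, j)"
      by (simp add: scalar_prod_def)
  qed auto
  then show ?thesis
    unfolding block_det_def by (simp add: det_mult [where n = ?n])
qed

lemma block_det_upper_triangular:
  assumes "\<And>i j. p \<le> j \<Longrightarrow> j < i \<Longrightarrow> i \<le> q \<Longrightarrow> A i j = 0"
  shows "block_det p q A = (\<Prod>i = p..q. A i i)"
proof -
  let ?n = "q + 1 - p"
  let ?M = "mat ?n ?n (\<lambda>(i, j). A (i + p) (j + p))"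
  have "det ?M = prod_list (diag_mat ?M)"
    by (rule det_upper_triangular [where n = ?n]) (use assms in auto)
  also have "\<dots> = (\<Prod>i = 0..<?n. A (i + p) (i + p))"
    by (simp add: prod_list_diag_prod)
  finally show ?thesis using prod_shift_block [of "\<lambda>i. A i i"] by (simp add: block_det_def)
qed

lemma block_det_transpose: "block_det p q (\<lambda>i j. A j i) = block_det p q A"
proof -
  let ?n = "q + 1 - p"
  have "mat ?n ?n (\<lambda>(i, j). A (j + p) (i + p)) = (mat ?n ?n (\<lambda>(i, j). A (i + p) (j + p)))\<^sup>T"
    by (rule eq_matI) auto
  then show ?thesis
    unfolding block_det_def by (simp add: det_transpose [where n = ?n])
qed

text \<open>For \<open>p = Suc q\<close> the smaller determinant is empty and equals 1. This
  boundary case does occur, for instance when truncating from one variable to none.\<close>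

lemma block_det_last_row:
  assumes "p \<le> Suc q" and zero: "\<And>j. p \<le> j \<Longrightarrow> j \<le> q \<Longrightarrow> A (Suc q) j = 0"
  shows "block_det p (Suc q) A = block_det p q A * A (Suc q) (Suc q)"
proof -
  let ?n = "q + 1 - p"
  \<comment> \<open>The matrix is transposed, so that the zero entries of the last row become a zero
    block in the upper right corner.\<close>
  let ?M = "mat ?n ?n (\<lambda>(i, j). A (j + p) (i + p))"
  let ?L = "mat 1 ?n (\<lambda>(i, j). A (j + p) (Suc q))"
  let ?D = "mat 1 1 (\<lambda>_. A (Suc q) (Suc q))"
  have "mat (Suc ?n) (Suc ?n) (\<lambda>(i, j). A (j + p) (i + p)) =
      four_block_mat ?M (0\<^sub>m ?n 1) ?L ?D"
  proof (rule eq_matI)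
    fix i j assume "i < dim_row (four_block_mat ?M (0\<^sub>m ?n 1) ?L ?D)"
      and "j < dim_col (four_block_mat ?M (0\<^sub>m ?n 1) ?L ?D)"
    then have "i < ?n \<or> i + p = Suc q" "j < ?n \<or> j + p = Suc q" "i < Suc ?n" "j < Suc ?n"
      using assms(1) by auto
    then show "mat (Suc ?n) (Suc ?n) (\<lambda>(i, j). A (j + p) (i + p)) $$ (i, j) =
        four_block_mat ?M (0\<^sub>m ?n 1) ?L ?D $$ (i, j)"
      using zero by auto
  qed auto
  moreover have "det (four_block_mat ?M (0\<^sub>m ?n 1) ?L ?D) = det ?M * det ?D"
    by (rule det_four_block_mat_upper_right_zero_col [where n = ?n]) auto
  moreover have "Suc q + 1 - p = Suc ?n" using assms(1) by simp
  ultimately have "block_det p (Suc q) (\<lambda>i j. A j i) = block_det p q (\<lambda>i j. A j i) * det ?D"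
    unfolding block_det_def by simp
  also have "det ?D = A (Suc q) (Suc q)"
    by (simp add: det_single)
  finally show ?thesis by (simp only: block_det_transpose [where A = A])
qed

lemma block_det_split:
  fixes A :: "nat \<Rightarrow> nat \<Rightarrow> 'a::idom"
  assumes "p \<le> Suc q" "q \<le> r" and zero: "\<And>i j. p \<le> i \<Longrightarrow> i \<le> q \<Longrightarrow> q < j \<Longrightarrow> j \<le> r \<Longrightarrow> A i j = 0"
  shows "block_det p r A = block_det p q A * block_det (Suc q) r A"
proof -
  define n m where "n = q + 1 - p" and "m = r - q"
  have nm: "r + 1 - p = n + m" "q + 1 - p = n" "r + 1 - Suc q = m" and q: "Suc q = n + p"
    using assms by (auto simp: n_def m_def)
  let ?M = "\<lambda>a n b k. mat n k (\<lambda>(i, j). A (i + a) (j + b))"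
  have zero': "A (i + p) (j + p) = 0" if "i < n" "n \<le> j" "j < n + m" for i j
    using that zero [of "i + p" "j + p"] nm q assms(1,2) by simp
  have "?M p (n + m) p (n + m) =
      four_block_mat (?M p n p n) (0\<^sub>m n m) (?M (n + p) m p n) (?M (n + p) m (n + p) m)"
    using zero' by (intro eq_matI) (auto simp: not_less)
  then have "det (?M p (n + m) p (n + m)) = det (?M p n p n) * det (?M (n + p) m (n + p) m)"
    by (simp only: det_four_block_mat_upper_right_zero [OF mat_carrier refl mat_carrier mat_carrier])
  then show ?thesis
    unfolding block_det_def nm by (simp only: q)
qed

text \<open>Matrix indices start at 0, so \<sigma> is conjugated by the shift into a permutation
  \<tau> of \<open>{0..<n}\<close>, which has the same sign.\<close>

lemma block_det_permute_rows:
  assumes \<sigma>: "\<sigma> permutes {1..n}"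
  shows "block_det 1 n (\<lambda>i j. A (\<sigma> i) j) = of_int (sign \<sigma>) * block_det 1 n A"
proof -
  define \<tau> where "\<tau> = map_permutation {1..n} (\<lambda>i. i - 1) \<sigma>"
  have inj: "inj_on (\<lambda>i. i - 1) {1..n}" by (auto simp: inj_on_def)
  have img: "(\<lambda>i. i - 1) ` {1..n} = {0..<n}"
  proof -
    have "i \<in> (\<lambda>i. i - 1) ` {1..n}" if "i < n" for i
      using that by (intro image_eqI [of _ _ "Suc i"]) auto
    then show ?thesis by auto
  qed
  have \<tau>: "\<tau> permutes {0..<n}"
    unfolding \<tau>_def img [symmetric]
    by (rule map_permutation_permutes [OF inj_on_imp_bij_betw [OF inj] \<sigma>])
  have sgn: "sign \<tau> = sign \<sigma>"
    unfolding \<tau>_def by (rule sign_map_permutation) (use inj \<sigma> in auto)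
  have \<sigma>_eq: "\<sigma> (i + 1) = \<tau> i + 1" if "i < n" for i
  proof -
    have "\<tau> (i + 1 - 1) = \<sigma> (i + 1) - 1"
      unfolding \<tau>_def using map_permutation_apply [OF inj, of "i + 1" \<sigma>] that by simp
    moreover have "\<sigma> (i + 1) \<in> {1..n}"
      using permutes_in_image [OF \<sigma>, of "i + 1"] that by simp
    ultimately show ?thesis by simp
  qed
  let ?M = "mat n n (\<lambda>(i, j). A (i + 1) (j + 1))"
  have \<tau>_less: "\<tau> i < n" if "i < n" for i
    using permutes_in_image [OF \<tau>, of i] that by simp
  have "mat n n (\<lambda>(i, j). A (\<sigma> (i + 1)) (j + 1)) = mat n n (\<lambda>(i, j). ?M $$ (\<tau> i, j))"
    using \<sigma>_eq \<tau>_less by (intro eq_matI) auto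
  then show ?thesis
    using det_permute_rows [OF _ \<tau>, of ?M] by (simp add: block_det_def sgn)
qed

lemma block_det_identical_rows:
  assumes "i \<noteq> k" "p \<le> i" "i \<le> q" "p \<le> k" "k \<le> q" "\<And>j. A i j = A k j"
  shows "block_det p q A = 0"
  unfolding block_det_def
proof (rule det_identical_rows [where n = "q + 1 - p" and i = "i - p" and j = "k - p"])
  let ?M = "mat (q + 1 - p) (q + 1 - p) (\<lambda>(i, j). A (i + p) (j + p))"
  show "row ?M (i - p) = row ?M (k - p)"
    using assms(1-5) by (intro eq_vecI) (simp_all add: assms(6))
qed (use assms(1-5) in auto)

subsection \<open>Formal power series\<close>

lemma mps_coeff_zero [simp]: "mps_coeff 0 m = 0"
  by (simp add: zero_mps.rep_eq)

lemma mps_coeff_one: "mps_coeff 1 m = (if m = 0 then 1 else 0)"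
  by (simp add: one_mps.rep_eq)

lemma mps_coeff_add [simp]: "mps_coeff (f + g) m = mps_coeff f m + mps_coeff g m"
  by (simp add: plus_mps.rep_eq)

lemma mps_coeff_diff [simp]: "mps_coeff (f - g) m = mps_coeff f m - mps_coeff g m"
  by (simp add: minus_mps.rep_eq)

lemma mps_coeff_sum: "mps_coeff (\<Sum>i\<in>A. f i) m = (\<Sum>i\<in>A. mps_coeff (f i) m)"
  by (induction A rule: infinite_finite_induct) auto

lemma mps_coeff_times: "mps_coeff (f * g) m = (\<Sum>(p, q)\<in>splits m. mps_coeff f p * mps_coeff g q)"
  by (simp add: times_mps.rep_eq)

text \<open>Only coefficients at divisors of \<open>m\<close> matter, so the factors may be replaced
  as long as the relevant products agree. This is how truncation is shown to be
  multiplicative.\<close>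

lemma mps_coeff_times_cong:
  assumes "\<And>p q. p + q = m \<Longrightarrow> mps_coeff f p * mps_coeff g q = mps_coeff f' p * mps_coeff g' q"
  shows "mps_coeff (f * g) m = mps_coeff (f' * g') m"
  unfolding mps_coeff_times by (rule sum.cong) (use assms in \<open>auto simp: splits_def\<close>)

lemma mps_coeff_const_times [simp]:
  fixes m :: "'v \<Rightarrow>\<^sub>0 nat"
  shows "mps_coeff (mps_const c * f) m = c * mps_coeff f m"
proof -
  have "mps_coeff (mps_const c * f) m = (\<Sum>(p, q)\<in>{(0 :: 'v \<Rightarrow>\<^sub>0 nat, m)}. mps_coeff (mps_const c) p * mps_coeff f q)"
    unfolding mps_coeff_times
    by (rule sum.mono_neutral_right [OF finite_splits]) (auto simp: splits_def mps_const.rep_eq split: if_splits)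
  then show ?thesis by (simp add: mps_const.rep_eq)
qed

lemma mps_coeff_of_int_times [simp]:
  fixes f :: "('v, 'a::comm_ring_1) mps"
  shows "mps_coeff (of_int k * f) m = of_int k * mps_coeff f m"
proof -
  have "mps_const (of_int k) = (of_int k :: ('v, 'a) mps)"
  proof (induction k rule: int_induct [where k = 0])
    case base
    show ?case by (rule mps_eqI) (simp add: mps_const.rep_eq)
  next
    case (step1 i)
    have "mps_const (of_int (i + 1)) = mps_const (of_int i) + (1 :: ('v, 'a) mps)"
      by (intro mps_eqI) (simp add: mps_const.rep_eq mps_coeff_one)
    with step1 show ?case by simp
  next
    case (step2 i)
    have "mps_const (of_int (i - 1)) = mps_const (of_int i) - (1 :: ('v, 'a) mps)"
      by (intro mps_eqI) (simp add: mps_const.rep_eq mps_coeff_one)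
    with step2 show ?case by simp
  qed
  then show ?thesis by (metis mps_coeff_const_times)
qed

lemma mps_coeff_var_times_add [simp]:
  "mps_coeff (mps_var v * f) (Poly_Mapping.single v (Suc 0) + m) = mps_coeff f m"
proof -
  have "mps_coeff (mps_var v * f) (Poly_Mapping.single v (Suc 0) + m) =
      (\<Sum>(p, q)\<in>{(Poly_Mapping.single v (Suc 0), m)}. mps_coeff (mps_var v) p * mps_coeff f q)"
    unfolding mps_coeff_times
    by (rule sum.mono_neutral_right [OF finite_splits])
      (auto simp: splits_def mps_var.rep_eq split: if_splits)
  then show ?thesis by (simp add: mps_var.rep_eq)
qed

lemma mps_coeff_var_times_0:
  fixes f :: "('v, 'a::comm_ring_1) mps"
  assumes "Poly_Mapping.lookup m v = 0"
  shows "mps_coeff (mps_var v * f) m = 0"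
proof -
  have "mps_coeff (mps_var v :: ('v, 'a) mps) (fst z) = 0" if "z \<in> splits m" for z
    using assms that by (auto simp: splits_def mps_var.rep_eq lookup_add)
  then show ?thesis
    unfolding mps_coeff_times by (intro sum.neutral) (auto simp: case_prod_beta)
qed

lemma lookup_pos_decompose:
  fixes m :: "'v \<Rightarrow>\<^sub>0 nat"
  assumes "Poly_Mapping.lookup m v = Suc n"
  obtains m' where "m = Poly_Mapping.single v (Suc 0) + m'" "Poly_Mapping.lookup m' v = n"
proof
  show "m = Poly_Mapping.single v (Suc 0) + (m - Poly_Mapping.single v (Suc 0))"
    using assms by (intro poly_mapping_eqI) (auto simp: lookup_add lookup_minus lookup_single when_def)
  show "Poly_Mapping.lookup (m - Poly_Mapping.single v (Suc 0)) v = n"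
    using assms by (simp add: lookup_minus)
qed

text \<open>The definition sums over the exact support; here any finite part of \<open>I\<close>
  containing the support will do, so the support need not be determined.\<close>

lemma mps_has_sumI:
  assumes "\<And>m. finite (J m)" "\<And>m. J m \<subseteq> I"
    and "\<And>m i. i \<in> I \<Longrightarrow> i \<notin> J m \<Longrightarrow> mps_coeff (f i) m = 0"
    and "\<And>m. mps_coeff g m = (\<Sum>i\<in>J m. mps_coeff (f i) m)"
  shows "mps_has_sum f I g"
  unfolding mps_has_sum_def
proof (intro allI conjI)
  fix m
  have sub: "{i \<in> I. mps_coeff (f i) m \<noteq> 0} \<subseteq> J m" using assms(3) by blast
  then show "finite {i \<in> I. mps_coeff (f i) m \<noteq> 0}" using assms(1) finite_subset by blast
  show "mps_coeff g m = (\<Sum>i | i \<in> I \<and> mps_coeff (f i) m \<noteq> 0. mps_coeff (f i) m)"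
    unfolding assms(4) by (rule sum.mono_neutral_right) (use assms(1,2) sub in auto)
qed

lemma mps_has_sumD:
  assumes "mps_has_sum f I g" "finite J" "J \<subseteq> I" "\<And>i. i \<in> I \<Longrightarrow> i \<notin> J \<Longrightarrow> mps_coeff (f i) m = 0"
  shows "mps_coeff g m = (\<Sum>i\<in>J. mps_coeff (f i) m)"
proof -
  have "mps_coeff g m = (\<Sum>i | i \<in> I \<and> mps_coeff (f i) m \<noteq> 0. mps_coeff (f i) m)"
    using assms(1) by (simp add: mps_has_sum_def)
  also have "\<dots> = (\<Sum>i\<in>J. mps_coeff (f i) m)"
    by (rule sum.mono_neutral_left) (use assms in auto)
  finally show ?thesis .
qed

lemma mps_has_sum_unique:
  assumes "mps_has_sum f I g" "mps_has_sum f I g'"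
  shows "g = g'"
  using assms by (intro mps_eqI) (simp add: mps_has_sum_def)

lemma mps_has_sum_times_right:
  assumes "mps_has_sum f I g"
  shows "mps_has_sum (\<lambda>i. f i * h) I (g * h)"
proof (rule mps_has_sumI)
  fix m
  \<comment> \<open>The indices that contribute at some divisor of \<open>m\<close>; there are
    finitely many divisors.\<close>
  let ?J = "\<Union>(p, q)\<in>splits m. {i \<in> I. mps_coeff (f i) p \<noteq> 0}"
  show fin: "finite ?J"
    using assms by (auto simp: mps_has_sum_def finite_splits)
  show sub: "?J \<subseteq> I" by auto
  show "mps_coeff (f i * h) m = 0" if "i \<in> I" "i \<notin> ?J" for i
    unfolding mps_coeff_times using that by (intro sum.neutral) auto
  have "mps_coeff g p = (\<Sum>i\<in>?J. mps_coeff (f i) p)" if "(p, q) \<in> splits m" for p q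
    using that by (intro mps_has_sumD [OF assms fin sub]) auto
  then show "mps_coeff (g * h) m = (\<Sum>i\<in>?J. mps_coeff (f i * h) m)"
    unfolding mps_coeff_times
    by (subst sum.swap) (auto intro!: sum.cong simp: sum_distrib_right)
qed

section \<open>Cancellable series and exact quotients\<close>

definition nonzerodiv :: "'a::comm_ring_1 \<Rightarrow> bool" where
  "nonzerodiv g \<longleftrightarrow> (\<forall>f. f * g = 0 \<longrightarrow> f = 0)"

lemma exact_quot_eqI:
  assumes "nonzerodiv g" "q * g = f"
  shows "exact_quot f g = q"
  unfolding exact_quot_def
proof (rule the_equality)
  fix q' assume "q' * g = f"
  then have "(q' - q) * g = 0" using assms(2) by (simp add: algebra_simps)
  then show "q' = q" using assms(1) unfolding nonzerodiv_def by fastforce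
qed (fact assms(2))

lemma nonzerodiv_prod:
  assumes "\<And>i. i \<in> A \<Longrightarrow> nonzerodiv (f i)"
  shows "nonzerodiv (\<Prod>i\<in>A. f i)"
  using assms
proof (induction A rule: infinite_finite_induct)
  case (insert x A)
  show ?case
    unfolding nonzerodiv_def
  proof (intro allI impI)
    fix g assume "g * (\<Prod>i\<in>insert x A. f i) = 0"
    then have "(g * f x) * (\<Prod>i\<in>A. f i) = 0" using insert.hyps by (simp add: mult.assoc)
    moreover have "nonzerodiv (\<Prod>i\<in>A. f i)" "nonzerodiv (f x)" using insert by auto
    ultimately show "g = 0" unfolding nonzerodiv_def by metis
  qed
qed (auto simp: nonzerodiv_def)

text \<open>If \<open>x_v f = x_w f\<close>, then the coefficient of \<open>f\<close> at a monomial
  is unchanged when one factor \<open>x_w\<close> is traded for \<open>x_v\<close>. After all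
  factors \<open>x_w\<close> are spent, one more comparison gives 0; hence the induction on the
  exponent of \<open>w\<close>.\<close>

lemma nonzerodiv_var_diff:
  assumes "v \<noteq> w"
  shows "nonzerodiv (mps_var v - mps_var w :: ('v, 'a::comm_ring_1) mps)"
  unfolding nonzerodiv_def
proof (intro allI impI mps_eqI)
  fix f :: "('v, 'a) mps" and m
  assume "f * (mps_var v - mps_var w) = 0"
  then have eq: "mps_var v * f = mps_var w * f" by (simp add: algebra_simps)
  show "mps_coeff f m = mps_coeff 0 m"
  proof (induction "Poly_Mapping.lookup m w" arbitrary: m)
    case 0
    have "mps_coeff f m = mps_coeff (mps_var w * f) (Poly_Mapping.single v (Suc 0) + m)"
      by (simp flip: eq)
    also have "\<dots> = 0"
      using 0 assms by (intro mps_coeff_var_times_0) (simp add: lookup_add lookup_single)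
    finally show ?case by simp
  next
    case (Suc n)
    obtain m' where m': "m = Poly_Mapping.single w (Suc 0) + m'" "Poly_Mapping.lookup m' w = n"
      using lookup_pos_decompose Suc(2) by metis
    have "mps_coeff f m = mps_coeff (mps_var w * f) (Poly_Mapping.single v (Suc 0) + m)"
      by (simp flip: eq)
    also have "Poly_Mapping.single v (Suc 0) + m = Poly_Mapping.single w (Suc 0) + (Poly_Mapping.single v (Suc 0) + m')"
      by (simp add: m'(1) ac_simps)
    also have "mps_coeff (mps_var w * f) \<dots> = mps_coeff f (Poly_Mapping.single v (Suc 0) + m')"
      by (rule mps_coeff_var_times_add)
    also have "\<dots> = 0"
      using Suc(1) [of "Poly_Mapping.single v (Suc 0) + m'"] m'(2) assms by (simp add: lookup_add lookup_single)
    finally show ?case by simp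
  qed
qed

text \<open>From \<open>f = c x_v f\<close>, each coefficient is \<open>c\<close> times the one at
  the monomial divided by \<open>x_v\<close>, and it is 0 if \<open>x_v\<close> does not
  occur.\<close>

lemma nonzerodiv_one_minus_var:
  "nonzerodiv (1 - mps_const c * mps_var v :: ('v, 'a::comm_ring_1) mps)"
  unfolding nonzerodiv_def
proof (intro allI impI mps_eqI)
  fix f :: "('v, 'a) mps" and m
  assume "f * (1 - mps_const c * mps_var v) = 0"
  then have eq: "f = mps_const c * (mps_var v * f)" by (simp add: algebra_simps)
  show "mps_coeff f m = mps_coeff 0 m"
  proof (induction "Poly_Mapping.lookup m v" arbitrary: m)
    case 0
    show ?case by (subst eq) (simp add: mps_coeff_var_times_0 0(1) [symmetric])
  next
    case (Suc n)
    then obtain m' where "m = Poly_Mapping.single v (Suc 0) + m'" "Poly_Mapping.lookup m' v = n"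
      using lookup_pos_decompose by metis
    with Suc(1) [of m'] show ?case by (subst eq) simp
  qed
qed

section \<open>Series in a single variable, given by their coefficient sequence\<close>

lift_definition mps_univ :: "'v \<Rightarrow> (nat \<Rightarrow> 'a) \<Rightarrow> ('v, 'a::comm_ring_1) mps" is
  "\<lambda>v g m. if Poly_Mapping.keys m \<subseteq> {v} then g (Poly_Mapping.lookup m v) else 0" .

lemma mps_univ_delta: "mps_univ v (\<lambda>k. if k = 0 then 1 else 0) = 1"
  by (intro mps_eqI)
    (auto simp: mps_coeff_one mps_univ.rep_eq intro!: poly_mapping_eqI dest!: subsetD simp: in_keys_iff)

lemma mps_var_times_univ:
  "mps_var v * mps_univ v g = mps_univ v (\<lambda>k. if k = 0 then 0 else g (k - 1))"
proof (rule mps_eqI)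
  fix m
  show "mps_coeff (mps_var v * mps_univ v g) m =
      mps_coeff (mps_univ v (\<lambda>k. if k = 0 then 0 else g (k - 1))) m"
  proof (cases "Poly_Mapping.lookup m v")
    case 0
    then show ?thesis by (simp add: mps_coeff_var_times_0 mps_univ.rep_eq)
  next
    case (Suc l)
    then obtain m' where m': "m = Poly_Mapping.single v (Suc 0) + m'" "Poly_Mapping.lookup m' v = l"
      by (rule lookup_pos_decompose)
    then have "Poly_Mapping.keys m \<subseteq> {v} \<longleftrightarrow> Poly_Mapping.keys m' \<subseteq> {v}"
      by (auto simp: subset_iff in_keys_iff lookup_add lookup_single when_def)
    then show ?thesis
      using m' by (simp add: mps_univ.rep_eq lookup_add)
  qed
qed

lemma mps_var_power_times_univ:
  "mps_var v ^ n * mps_univ v g = mps_univ v (\<lambda>k. if k < n then 0 else g (k - n))"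
proof (induction n)
  case (Suc n)
  have "mps_var v ^ Suc n * mps_univ v g = mps_var v * (mps_var v ^ n * mps_univ v g)"
    by (simp add: mult.assoc)
  also have "\<dots> = mps_univ v (\<lambda>k. if k < Suc n then 0 else g (k - Suc n))"
    unfolding Suc mps_var_times_univ by (intro arg_cong [where f = "mps_univ v"] ext) auto
  finally show ?case .
qed simp

lemma mps_univ_power: "mps_var v ^ n = mps_univ v (\<lambda>k. if k = n then 1 else 0)"
proof -
  have "mps_var v ^ n * mps_univ v (\<lambda>k. if k = 0 then 1 else 0) =
      mps_univ v (\<lambda>k. if k = n then 1 else 0)"
    unfolding mps_var_power_times_univ by (intro arg_cong [where f = "mps_univ v"] ext) auto
  then show ?thesis by (simp add: mps_univ_delta)
qed

lemma mps_univ_times_one_minus_var: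
  "mps_univ v g * (1 - mps_const c * mps_var v) =
     mps_univ v (\<lambda>k. if k = 0 then g 0 else g k - c * g (k - 1))"
proof -
  have "mps_univ v g * (1 - mps_const c * mps_var v) =
      mps_univ v g - mps_const c * (mps_var v * mps_univ v g)"
    by (simp add: algebra_simps)
  then show ?thesis
    unfolding mps_var_times_univ by (intro mps_eqI) (simp add: mps_univ.rep_eq)
qed

text \<open>A monomial in the variables of \<open>insert v S\<close> factors in exactly one way into
  a power of \<open>x_v\<close> and a monomial in the variables of \<open>S\<close>, so only one
  term of the convolution survives.\<close>

lemma mps_coeff_prod_univ:
  assumes "finite S"
  shows "mps_coeff (\<Prod>v\<in>S. mps_univ v (g v)) m =
    (if Poly_Mapping.keys m \<subseteq> S then \<Prod>v\<in>S. g v (Poly_Mapping.lookup m v) else 0)"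
  using assms
proof (induction S arbitrary: m rule: finite_induct)
  case empty
  then show ?case by (auto simp: mps_coeff_one)
next
  case (insert v S)
  define p where "p = Poly_Mapping.single v (Poly_Mapping.lookup m v)"
  define q where "q = m - p"
  have pq: "p + q = m"
    by (rule poly_mapping_eqI) (simp add: p_def q_def lookup_add lookup_minus lookup_single when_def)
  have lq: "Poly_Mapping.lookup q w = (if w = v then 0 else Poly_Mapping.lookup m w)" for w
    by (simp add: p_def q_def lookup_minus lookup_single when_def)
  have unique: "p' = p \<and> q' = q"
    if "p' + q' = m" "Poly_Mapping.keys p' \<subseteq> {v}" "Poly_Mapping.keys q' \<subseteq> S" for p' q'
  proof -
    have "p' = p"
    proof (rule poly_mapping_eqI)
      fix w
      have "Poly_Mapping.lookup q' v = 0" using insert(2) that(3) by (auto simp: in_keys_iff)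
      then have "Poly_Mapping.lookup p' v = Poly_Mapping.lookup m v"
        by (simp add: that(1) [symmetric] lookup_add)
      moreover have "Poly_Mapping.lookup p' w = 0" if "w \<noteq> v"
        using \<open>Poly_Mapping.keys p' \<subseteq> {v}\<close> that by (auto simp: in_keys_iff)
      ultimately show "Poly_Mapping.lookup p' w = Poly_Mapping.lookup p w"
        by (auto simp: p_def lookup_single when_def)
    qed
    with that(1) pq show ?thesis by auto
  qed
  have "mps_coeff (\<Prod>w\<in>insert v S. mps_univ w (g w)) m =
      mps_coeff (mps_univ v (g v) * (\<Prod>w\<in>S. mps_univ w (g w))) m"
    using insert by simp
  also have "\<dots> = (\<Sum>(p', q')\<in>{(p, q)}. mps_coeff (mps_univ v (g v)) p' *
      mps_coeff (\<Prod>w\<in>S. mps_univ w (g w)) q')"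
    unfolding mps_coeff_times
  proof (rule sum.mono_neutral_right)
    show "\<forall>z\<in>splits m - {(p, q)}. (case z of (p', q') \<Rightarrow> mps_coeff (mps_univ v (g v)) p' *
        mps_coeff (\<Prod>w\<in>S. mps_univ w (g w)) q') = 0"
    proof (intro ballI)
      fix z assume z: "z \<in> splits m - {(p, q)}"
      obtain p' q' where [simp]: "z = (p', q')" by (cases z)
      have "\<not> (Poly_Mapping.keys p' \<subseteq> {v} \<and> Poly_Mapping.keys q' \<subseteq> S)"
        using z unique [of p' q'] by (auto simp: splits_def)
      then show "(case z of (p', q') \<Rightarrow> mps_coeff (mps_univ v (g v)) p' *
          mps_coeff (\<Prod>w\<in>S. mps_univ w (g w)) q') = 0"
        by (auto simp: mps_univ.rep_eq insert.IH)
    qed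
  qed (use finite_splits [of m] in \<open>simp_all add: splits_def pq\<close>)
  also have "\<dots> = g v (Poly_Mapping.lookup m v) *
      (if Poly_Mapping.keys q \<subseteq> S then \<Prod>w\<in>S. g w (Poly_Mapping.lookup q w) else 0)"
    by (simp add: mps_univ.rep_eq insert.IH) (simp add: p_def)
  also have "Poly_Mapping.keys q \<subseteq> S \<longleftrightarrow> Poly_Mapping.keys m \<subseteq> insert v S"
    using lq insert(2) by (auto simp: subset_iff in_keys_iff)
  also have "(\<Prod>w\<in>S. g w (Poly_Mapping.lookup q w)) = (\<Prod>w\<in>S. g w (Poly_Mapping.lookup m w))"
    using insert(2) by (intro prod.cong) (auto simp: lq)
  finally show ?case using insert.hyps by simp
qed

text \<open>Since the $i$th row involves the variable $x_i$ alone, the coefficient of a monomial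
  is obtained by taking one coefficient in each row.\<close>

lemma mps_coeff_block_det_univ:
  fixes c :: "nat \<Rightarrow> nat \<Rightarrow> 'a::comm_ring_1"
  shows "mps_coeff (block_det 1 N (\<lambda>i j. mps_univ (i - 1) (c j))) m =
    (if Poly_Mapping.keys m \<subseteq> {..<N}
     then block_det 1 N (\<lambda>i j. c j (Poly_Mapping.lookup m (i - 1))) else 0)"
proof -
  have "mps_coeff (\<Prod>i = 0..<N. mps_univ i (c (\<pi> i + 1))) m =
      (if Poly_Mapping.keys m \<subseteq> {..<N}
       then \<Prod>i = 0..<N. c (\<pi> i + 1) (Poly_Mapping.lookup m i) else 0)" for \<pi>
    by (subst mps_coeff_prod_univ) (simp_all add: atLeast0LessThan)
  then show ?thesis
    by (simp add: block_det_leibniz mps_coeff_sum)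
qed

subsection \<open>Alternants and Schur functions\<close>

text \<open>The complete symmetric polynomial evaluated at ring elements. A list is used because
  values repeat: in the interpolation the point \<open>y\<close> is later one of the nodes.\<close>

fun complete_nat :: "nat \<Rightarrow> 'a::comm_ring_1 list \<Rightarrow> 'a" where
  "complete_nat 0 xs = 1"
| "complete_nat (Suc k) [] = 0"
| "complete_nat (Suc k) (x # xs) = complete_nat (Suc k) xs + x * complete_nat k (x # xs)"

definition complete_sym :: "int \<Rightarrow> 'a::comm_ring_1 list \<Rightarrow> 'a" where
  "complete_sym k xs = (if k < 0 then 0 else complete_nat (nat k) xs)"

lemma complete_sym_Nil: "complete_sym k [] = (if k = 0 then 1 else 0)"
  by (cases "nat k") (auto simp: complete_sym_def)

lemma complete_sym_Cons:
  "complete_sym k (x # xs) = complete_sym k xs + x * complete_sym (k - 1) (x # xs)"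
proof (cases "k \<le> 0")
  case False
  then obtain n where "k = int (Suc n)" by (metis gr0_implies_Suc not_le zero_less_imp_eq_int)
  then show ?thesis by (simp add: complete_sym_def nat_add_distrib)
qed (auto simp: complete_sym_def)

text \<open>The recursion is not visibly symmetric. Expanding twice and using symmetry in the two
  lower degrees, both sides become \<open>h_k(zs) + (x + y) H - x y H'\<close>.\<close>

lemma complete_nat_swap: "complete_nat k (x # y # zs) = complete_nat k (y # x # zs)"
proof (induction k rule: less_induct)
  case (less k)
  consider "k = 0" | "k = 1" | n where "k = Suc (Suc n)"
    by (metis One_nat_def not0_implies_Suc)
  then show ?case
  proof cases
    case 3
    define H where "H = complete_nat (Suc n) (x # y # zs)"
    define H' where "H' = complete_nat n (x # y # zs)"
    have H: "H = complete_nat (Suc n) (y # x # zs)"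
      unfolding H_def by (rule less) (use 3 in simp)
    have H': "H' = complete_nat n (y # x # zs)"
      unfolding H'_def by (rule less) (use 3 in simp)
    have "complete_nat (Suc n) (y # zs) = H - x * H'"
      by (simp add: H_def H'_def)
    moreover have "complete_nat (Suc n) (x # zs) = H - y * H'"
      by (simp add: H H')
    moreover have "complete_nat k (x # y # zs) =
        complete_nat (Suc (Suc n)) zs + y * complete_nat (Suc n) (y # zs) + x * H"
      unfolding 3 H_def by (simp only: complete_nat.simps)
    moreover have "complete_nat k (y # x # zs) =
        complete_nat (Suc (Suc n)) zs + x * complete_nat (Suc n) (x # zs) + y * H"
      unfolding 3 H by (simp only: complete_nat.simps)
    ultimately show ?thesis
      by (simp only:) (simp add: algebra_simps)
  qed (simp_all add: add.commute)
qed

text \<open>The divided difference of \<open>h_k\<close> in one argument, obtained by expanding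
  \<open>h_k(x, y, xs)\<close> along \<open>x\<close> and along \<open>y\<close>.\<close>

lemma complete_sym_diff:
  "complete_sym k (y # xs) - complete_sym k (x # xs) = (y - x) * complete_sym (k - 1) (y # x # xs)"
proof -
  have swap: "complete_sym k (x # y # xs) = complete_sym k (y # x # xs)" for k
    by (simp add: complete_sym_def complete_nat_swap)
  show ?thesis
    using complete_sym_Cons [of k y "x # xs"] complete_sym_Cons [of k x "y # xs"]
    by (simp add: swap algebra_simps)
qed

lemma complete_sym_singleton: "complete_sym (int p) [y] = y ^ p"
proof (induction p)
  case (Suc p)
  then show ?case
    using complete_sym_Cons [of "int (Suc p)" y "[]"] by (simp add: complete_sym_Nil)
qed (simp add: complete_sym_def)

text \<open>The Newton form of \<open>y ^ p\<close> with nodes \<open>x_N, ..., x_s\<close> and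
  remainder: the divided difference of the \<open>p\<close>-th power at \<open>x_k, ..., x_N\<close>
  is the complete symmetric polynomial of degree \<open>p - (N - k)\<close>. The induction runs
  downwards from \<open>s = Suc N\<close>, where there is no node and the remainder is
  \<open>h_p(y) = y ^ p\<close>; adding the node \<open>x_s\<close> is one application of
  \<open>complete_sym_diff\<close>.\<close>

lemma newton_interpolation_step:
  fixes x :: "nat \<Rightarrow> 'a::comm_ring_1"
  assumes "s \<le> Suc N"
  shows "y ^ p = (\<Sum>k = s..N. complete_sym (int p - int N + int k) (map x [k..<Suc N]) *
        (\<Prod>m = Suc k..N. y - x m)) +
      complete_sym (int p - int N - 1 + int s) (y # map x [s..<Suc N]) * (\<Prod>m = s..N. y - x m)"
  using assms
proof (induction s rule: inc_induct)
  case base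
  then show ?case by (simp add: complete_sym_singleton)
next
  case (step s)
  define xs where "xs = map x [Suc s..<Suc N]"
  define c where "c = int p - int N + int s"
  define P where "P = (\<Prod>m = Suc s..N. y - x m)"
  define S where "S = (\<Sum>k = Suc s..N. complete_sym (int p - int N + int k) (map x [k..<Suc N]) *
    (\<Prod>m = Suc k..N. y - x m))"
  have list: "map x [s..<Suc N] = x s # xs"
    unfolding xs_def using step by (subst upt_conv_Cons) auto
  have sum: "(\<Sum>k = s..N. complete_sym (int p - int N + int k) (map x [k..<Suc N]) *
      (\<Prod>m = Suc k..N. y - x m)) = complete_sym c (x s # xs) * P + S"
    using step by (simp only: sum.atLeast_Suc_atMost [of s] less_Suc_eq_le list c_def P_def S_def)
  have prod: "(\<Prod>m = s..N. y - x m) = (y - x s) * P"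
    using step by (simp only: prod.atLeast_Suc_atMost [of s] less_Suc_eq_le P_def)
  have "int p - int N - 1 + int (Suc s) = c" "int p - int N - 1 + int s = c - 1"
    by (simp_all add: c_def)
  note eqs = this step.IH [folded S_def P_def xs_def]
  have diff: "complete_sym c (y # xs) =
      complete_sym c (x s # xs) + (y - x s) * complete_sym (c - 1) (y # x s # xs)"
    using complete_sym_diff [of c y xs "x s"] by (simp add: algebra_simps)
  show ?case
    unfolding sum prod list eqs(2) eqs(3) [unfolded eqs(1) diff]
    by (simp add: algebra_simps)
qed

text \<open>With all of \<open>x_1, ..., x_N\<close> as nodes, the remainder at
  \<open>y = x i\<close> contains the factor \<open>x i - x i\<close>.\<close>

lemma newton_interpolation:
  fixes x :: "nat \<Rightarrow> 'a::comm_ring_1"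
  assumes "1 \<le> i" "i \<le> N"
  shows "x i ^ p = (\<Sum>k = 1..N. (\<Prod>m = Suc k..N. x i - x m) *
      complete_sym (int p - int N + int k) (map x [k..<Suc N]))"
proof -
  have "(\<Prod>m = 1..N. x i - x m) = 0"
    using assms by (intro prod_zero) auto
  then show ?thesis
    using newton_interpolation_step [of 1 N "x i" p x] by (simp add: mult.commute)
qed

text \<open>Interpolation writes the matrix of powers as a product. The left factor is upper
  triangular, because for \<open>k < i\<close> its entry contains \<open>x i - x i\<close>, and its
  diagonal entries multiply to the Vandermonde product.\<close>

lemma alternant_factorization:
  fixes x :: "nat \<Rightarrow> 'a::comm_ring_1"
  shows "block_det 1 N (\<lambda>i j. x i ^ p j) = (\<Prod>i = 1..N. \<Prod>m = Suc i..N. x i - x m) *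
    block_det 1 N (\<lambda>k j. complete_sym (int (p j) - int N + int k) (map x [k..<Suc N]))"
proof -
  have "block_det 1 N (\<lambda>i j. x i ^ p j) =
      block_det 1 N (\<lambda>i j. \<Sum>k = 1..N. (\<Prod>m = Suc k..N. x i - x m) *
        complete_sym (int (p j) - int N + int k) (map x [k..<Suc N]))"
    by (intro block_det_cong newton_interpolation)
  also have "\<dots> = block_det 1 N (\<lambda>i k. \<Prod>m = Suc k..N. x i - x m) *
      block_det 1 N (\<lambda>k j. complete_sym (int (p j) - int N + int k) (map x [k..<Suc N]))"
    by (rule block_det_mult)
  also have "block_det 1 N (\<lambda>i k. \<Prod>m = Suc k..N. x i - x m) =
      (\<Prod>i = 1..N. \<Prod>m = Suc i..N. x i - x m)"
    by (rule block_det_upper_triangular) (auto intro!: prod_zero)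
  finally show ?thesis .
qed

section \<open>Finite Schur functions as determinants\<close>

lemma vandermonde_eq: "vandermonde N = (\<Prod>i = 1..N. \<Prod>m = Suc i..N. xvar i - xvar m)"
proof -
  have "{(i, j). 1 \<le> i \<and> i < j \<and> j \<le> N} = Sigma {1..N} (\<lambda>i. {Suc i..N})" by auto
  then show ?thesis unfolding vandermonde_def by (simp add: prod.Sigma)
qed

lemma nonzerodiv_vandermonde: "nonzerodiv (vandermonde N)"
  unfolding vandermonde_def xvar_def
  by (rule nonzerodiv_prod) (auto intro!: nonzerodiv_var_diff)

text \<open>A flagged Jacobi-Trudi determinant, with row \<open>k\<close> using only
  \<open>x_k, ..., x_N\<close>. Unlike the quotient it can be truncated entry by entry, and its
  degree can be read off.\<close>

lemma schur_fin_eq: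
  assumes "length l \<le> N"
  shows "schur_fin N l = block_det 1 N
    (\<lambda>k j. complete_sym (int (part l j) - int j + int k) (map xvar [k..<Suc N]))" (is "_ = ?D")
    and "schur_fin N l * vandermonde N = block_det 1 N (\<lambda>i j. xvar i ^ (part l j + N - j))"
proof -
  have "block_det 1 N (\<lambda>i j. xvar i ^ (part l j + N - j)) = vandermonde N *
      block_det 1 N (\<lambda>k j. complete_sym (int (part l j + N - j) - int N + int k) (map xvar [k..<Suc N]))"
    unfolding vandermonde_eq by (rule alternant_factorization)
  also have "block_det 1 N (\<lambda>k j. complete_sym (int (part l j + N - j) - int N + int k)
      (map xvar [k..<Suc N])) = ?D"
    by (rule block_det_cong) (simp add: of_nat_diff algebra_simps)
  finally have eq: "block_det 1 N (\<lambda>i j. xvar i ^ (part l j + N - j)) = ?D * vandermonde N"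
    by (simp only: mult.commute)
  then show "schur_fin N l = ?D"
    using assms by (auto simp: schur_fin_def intro!: exact_quot_eqI nonzerodiv_vandermonde)
  with eq show "schur_fin N l * vandermonde N = block_det 1 N (\<lambda>i j. xvar i ^ (part l j + N - j))"
    by simp
qed

section \<open>Truncation to finitely many variables and stable limits\<close>

lemma comm_ring_hom_set_zero_above: "comm_ring_hom (set_zero_above N)"
proof
  fix f g :: "(nat, 'a) mps"
  show "set_zero_above N (f + g) = set_zero_above N f + set_zero_above N g"
    by (rule mps_eqI) (simp add: set_zero_above.rep_eq)
  show "set_zero_above N (f * g) = set_zero_above N f * set_zero_above N g"
  proof (rule mps_eqI)
    fix m
    have keys: "Poly_Mapping.keys (p + q) = Poly_Mapping.keys p \<union> Poly_Mapping.keys q"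
      for p q :: "nat \<Rightarrow>\<^sub>0 nat"
      by (auto simp: in_keys_iff lookup_add)
    show "mps_coeff (set_zero_above N (f * g)) m =
        mps_coeff (set_zero_above N f * set_zero_above N g) m"
    proof (cases "Poly_Mapping.keys m \<subseteq> {..<N}")
      case True
      then have "mps_coeff (set_zero_above N (f * g)) m = mps_coeff (f * g) m"
        by (simp add: set_zero_above.rep_eq)
      also have "\<dots> = mps_coeff (set_zero_above N f * set_zero_above N g) m"
        using True by (intro mps_coeff_times_cong) (auto simp: set_zero_above.rep_eq keys)
      finally show ?thesis .
    next
      case False
      \<comment> \<open>Zero is written as a product so that factors can be compared: if
        \<open>m\<close> involves a later variable, so does one of the two divisors.\<close>
      then have "mps_coeff (set_zero_above N (f * g)) m = mps_coeff (0 * 0 :: (nat, 'a) mps) m"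
        by (simp add: set_zero_above.rep_eq)
      also have "\<dots> = mps_coeff (set_zero_above N f * set_zero_above N g) m"
        using False by (intro mps_coeff_times_cong) (auto simp: set_zero_above.rep_eq keys)
      finally show ?thesis .
    qed
  qed
qed (rule mps_eqI, simp add: set_zero_above.rep_eq mps_coeff_one)+

text \<open>The assumption excludes \<open>xvar 0\<close>, which coincides with
  \<open>xvar 1\<close>.\<close>

lemma set_zero_above_xvar:
  assumes "1 \<le> i"
  shows "set_zero_above N (xvar i) = (if i \<le> N then xvar i else 0)"
  using assms
  by (intro mps_eqI) (auto simp: set_zero_above.rep_eq xvar_def mps_var.rep_eq)

lemma (in comm_ring_hom) hom_block_det: "hom (block_det p q A) = block_det p q (\<lambda>i j. hom (A i j))"
  unfolding block_det_def hom_det [symmetric] by (intro arg_cong [where f = det] eq_matI) auto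

lemma (in comm_ring_hom) hom_complete_sym: "hom (complete_sym k xs) = complete_sym k (map hom xs)"
proof -
  have "hom (complete_nat k xs) = complete_nat k (map hom xs)" for k
    by (induction k xs rule: complete_nat.induct) (simp_all add: hom_distribs)
  then show ?thesis by (simp add: complete_sym_def)
qed

lemma complete_sym_append_zero: "complete_sym k (xs @ [0]) = complete_sym k xs"
proof -
  have "complete_nat k (xs @ [0]) = complete_nat k xs" for k
    by (induction k xs rule: complete_nat.induct) simp_all
  then show ?thesis by (simp add: complete_sym_def)
qed

text \<open>Truncation drops \<open>x_(N+1)\<close> from every list and leaves the last row with no
  variables, hence with entries 0 or 1. If the partition has at most \<open>N\<close> parts, this
  row is \<open>(0, ..., 0, 1)\<close> and splits off; if it has \<open>N + 1\<close> parts, the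
  last one is positive and the row vanishes.\<close>

lemma set_zero_above_schur_fin:
  assumes "is_partition l"
  shows "set_zero_above N (schur_fin (Suc N) l) = schur_fin N l"
proof (cases "length l \<le> Suc N")
  case True
  interpret comm_ring_hom "set_zero_above N :: series \<Rightarrow> series"
    by (rule comm_ring_hom_set_zero_above)
  define H where "H N k j = complete_sym (int (part l j) - int j + int k) (map xvar [k..<Suc N])"
    for N k j
  have entry: "set_zero_above N (H (Suc N) k j) = H N k j" if "1 \<le> k" "k \<le> Suc N" for k j
  proof -
    have "map (set_zero_above N \<circ> xvar) [k..<Suc N] = map xvar [k..<Suc N]"
      using that by (auto simp: set_zero_above_xvar)
    moreover have "[k..<Suc (Suc N)] = [k..<Suc N] @ [Suc N]"
      using that by simp
    ultimately have "map (set_zero_above N) (map xvar [k..<Suc (Suc N)]) = map xvar [k..<Suc N] @ [0]"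
      by (simp add: set_zero_above_xvar)
    then show ?thesis
      unfolding H_def by (simp only: hom_complete_sym complete_sym_append_zero)
  qed
  have "set_zero_above N (schur_fin (Suc N) l) =
      block_det 1 (Suc N) (\<lambda>k j. set_zero_above N (H (Suc N) k j))"
    by (simp only: schur_fin_eq(1) [OF True] hom_block_det H_def)
  also have "\<dots> = block_det 1 (Suc N) (H N)"
    by (rule block_det_cong) (rule entry)
  finally have eq: "set_zero_above N (schur_fin (Suc N) l) = block_det 1 (Suc N) (H N)" .
  have last: "H N (Suc N) j = (if int (part l j) - int j + int (Suc N) = 0 then 1 else 0)" for j
    by (simp add: H_def complete_sym_Nil)
  show ?thesis
  proof (cases "length l \<le> N")
    case True
    have "block_det 1 (Suc N) (H N) = block_det 1 N (H N) * H N (Suc N) (Suc N)"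
      by (rule block_det_last_row) (auto simp: last)
    also have "H N (Suc N) (Suc N) = 1"
      using True by (simp add: last part_def)
    also have "block_det 1 N (H N) * 1 = schur_fin N l"
      unfolding H_def by (simp add: schur_fin_eq(1) [OF True] del: upt_Suc)
    finally show ?thesis by (simp add: eq)
  next
    case False
    have "H N (Suc N) j = 0" if "j \<le> Suc N" for j
    proof (cases "j = Suc N")
      case True
      have "l ! N \<in> set l"
        using False by simp
      then have "l ! N \<noteq> 0" using assms by (metis is_partition_def)
      then show ?thesis using True False by (simp add: last part_def)
    next
      case False
      then show ?thesis using that by (simp add: last)
    qed
    then have "block_det 1 (Suc N) (H N) = 0"
      by (intro block_det_zero_rectangle [where R = "{Suc N}" and C = "{1..Suc N}"]) auto
    moreover have "schur_fin N l = 0" using False by (simp add: schur_fin_def)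
    ultimately show ?thesis using eq by simp
  qed
next
  case False
  then show ?thesis
    by (intro mps_eqI) (simp add: schur_fin_def set_zero_above.rep_eq)
qed

text \<open>Each monomial involves finitely many variables, so its coefficient is visible in some
  truncation.\<close>

lemma stable_limit_eqI:
  assumes "\<And>N. set_zero_above N f = F N"
  shows "stable_limit F = f"
  unfolding stable_limit_def
proof (rule the_equality)
  fix g assume g: "\<forall>N. set_zero_above N g = F N"
  show "g = f"
  proof (rule mps_eqI)
    fix m :: "nat \<Rightarrow>\<^sub>0 nat"
    obtain N where N: "Poly_Mapping.keys m \<subseteq> {..<N}"
      using finite_nat_bounded [OF finite_keys [of m]] by blast
    have "mps_coeff (set_zero_above N g) m = mps_coeff (set_zero_above N f) m"
      using g assms by simp
    then show "mps_coeff g m = mps_coeff f m"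
      using N by (simp add: set_zero_above.rep_eq)
  qed
qed (use assms in blast)

lemma set_zero_above_stable_limit:
  assumes stable: "\<And>N. set_zero_above N (F (Suc N)) = F N"
  shows "set_zero_above N (stable_limit F) = F N"
proof -
  have mono: "mps_coeff (F (M + n)) m = mps_coeff (F M) m" if "Poly_Mapping.keys m \<subseteq> {..<M}" for M n m
  proof (induction n)
    case (Suc n)
    have "mps_coeff (F (M + n)) m = mps_coeff (set_zero_above (M + n) (F (Suc (M + n)))) m"
      by (simp add: stable)
    also have "\<dots> = mps_coeff (F (M + Suc n)) m"
      using that by (auto simp: set_zero_above.rep_eq)
    finally show ?case using Suc by simp
  qed simp
  have eq: "mps_coeff (F M) m = mps_coeff (F N) m"
    if "Poly_Mapping.keys m \<subseteq> {..<M}" "Poly_Mapping.keys m \<subseteq> {..<N}" for M N m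
    using mono [OF that(1), of "N - M"] mono [OF that(2), of "M - N"] by (cases "M \<le> N") auto
  \<comment> \<open>Any number of variables sufficient for \<open>m\<close> serves; by
    \<open>eq\<close> the coefficient does not depend on the choice.\<close>
  define B where "B m = (SOME N. Poly_Mapping.keys m \<subseteq> {..<N})" for m :: "nat \<Rightarrow>\<^sub>0 nat"
  have B: "Poly_Mapping.keys m \<subseteq> {..<B m}" for m
    unfolding B_def by (rule someI_ex) (rule finite_nat_bounded [OF finite_keys])
  define f where "f = Abs_mps (\<lambda>m. mps_coeff (F (B m)) m)"
  have f: "mps_coeff f m = mps_coeff (F (B m)) m" for m
    by (simp add: f_def Abs_mps_inverse)
  have "set_zero_above N f = F N" for N
  proof (rule mps_eqI)
    fix m
    show "mps_coeff (set_zero_above N f) m = mps_coeff (F N) m"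
    proof (cases "Poly_Mapping.keys m \<subseteq> {..<N}")
      case True
      then show ?thesis using eq [OF B True] by (simp add: set_zero_above.rep_eq f)
    next
      case False
      then have "mps_coeff (F N) m = 0"
        using stable [of N] by (metis set_zero_above.rep_eq)
      with False show ?thesis by (simp add: set_zero_above.rep_eq)
    qed
  qed
  then show ?thesis using stable_limit_eqI by metis
qed

lemma set_zero_above_schur:
  assumes "is_partition l"
  shows "set_zero_above N (schur l) = schur_fin N l"
  unfolding schur_def using assms
  by (intro set_zero_above_stable_limit set_zero_above_schur_fin)

section \<open>Homogeneity\<close>

definition mdeg :: "('v \<Rightarrow>\<^sub>0 nat) \<Rightarrow> nat" where
  "mdeg m = (\<Sum>v\<in>Poly_Mapping.keys m. Poly_Mapping.lookup m v)"

lemma mdeg_add: "mdeg (p + q) = mdeg p + mdeg q"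
proof -
  let ?S = "Poly_Mapping.keys p \<union> Poly_Mapping.keys q"
  have "mdeg r = (\<Sum>v\<in>?S. Poly_Mapping.lookup r v)" if "Poly_Mapping.keys r \<subseteq> ?S" for r
    unfolding mdeg_def using that by (intro sum.mono_neutral_left) (auto simp: in_keys_iff)
  then show ?thesis
    by (simp add: keys_add lookup_add sum.distrib)
qed

text \<open>Degrees are integers because determinant entries may have negative index; for
  \<open>k < 0\<close> only the zero series qualifies.\<close>

definition homogeneous :: "int \<Rightarrow> ('v, 'a::comm_ring_1) mps \<Rightarrow> bool" where
  "homogeneous k f \<longleftrightarrow> (\<forall>m. mps_coeff f m \<noteq> 0 \<longrightarrow> int (mdeg m) = k)"

lemma homogeneous_zero [simp]: "homogeneous k 0"
  by (simp add: homogeneous_def)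

lemma homogeneous_one: "homogeneous 0 1"
  by (simp add: homogeneous_def mps_coeff_one mdeg_def)

lemma homogeneous_add: "homogeneous k f \<Longrightarrow> homogeneous k g \<Longrightarrow> homogeneous k (f + g)"
  unfolding homogeneous_def by (metis add.right_neutral mps_coeff_add)

lemma homogeneous_sum: "(\<And>i. i \<in> A \<Longrightarrow> homogeneous k (f i)) \<Longrightarrow> homogeneous k (\<Sum>i\<in>A. f i)"
  by (induction A rule: infinite_finite_induct) (auto intro: homogeneous_add)

lemma homogeneous_of_int_times: "homogeneous k f \<Longrightarrow> homogeneous k (of_int c * f)"
  unfolding homogeneous_def by (metis mps_coeff_of_int_times mult_zero_right)

lemma homogeneous_times:
  assumes "homogeneous k f" "homogeneous l g"
  shows "homogeneous (k + l) (f * g)"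
  unfolding homogeneous_def
proof (intro allI impI)
  fix m assume "mps_coeff (f * g) m \<noteq> 0"
  then obtain z where "z \<in> splits m" "(case z of (p, q) \<Rightarrow> mps_coeff f p * mps_coeff g q) \<noteq> 0"
    unfolding mps_coeff_times by (meson sum.neutral)
  moreover obtain p q where "z = (p, q)" by (cases z)
  ultimately have "p + q = m" "mps_coeff f p \<noteq> 0" "mps_coeff g q \<noteq> 0"
    by (auto simp: splits_def)
  then show "int (mdeg m) = k + l"
    using assms by (auto simp: homogeneous_def mdeg_add)
qed

lemma homogeneous_prod:
  "(\<And>i. i \<in> A \<Longrightarrow> homogeneous (k i) (f i)) \<Longrightarrow> homogeneous (\<Sum>i\<in>A. k i) (\<Prod>i\<in>A. f i)"
  by (induction A rule: infinite_finite_induct) (auto intro: homogeneous_one homogeneous_times)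

lemma homogeneous_var: "homogeneous 1 (mps_var v)"
  by (simp add: homogeneous_def mps_var.rep_eq mdeg_def)

lemma homogeneous_complete_sym:
  assumes "\<And>x. x \<in> set xs \<Longrightarrow> homogeneous 1 x"
  shows "homogeneous k (complete_sym k xs)"
proof -
  have "homogeneous (int n) (complete_nat n xs)" for n
    using assms
  proof (induction n xs rule: complete_nat.induct)
    case (3 n x xs)
    have "homogeneous (1 + int n) (x * complete_nat n (x # xs))"
      using 3 by (intro homogeneous_times) auto
    with 3 show ?case by (auto intro: homogeneous_add)
  qed (auto intro: homogeneous_one)
  from this [of "nat k"] show ?thesis by (cases "k < 0") (simp_all add: complete_sym_def)
qed

text \<open>When entry degrees split into a row part and a column part, every Leibniz term has the
  same total degree.\<close>

lemma homogeneous_block_det: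
  assumes "\<And>i j. homogeneous (a i + b j) (A i j)"
  shows "homogeneous (\<Sum>i = p..q. a i + b i) (block_det p q A)"
proof -
  have "homogeneous (\<Sum>i = p..q. a i + b i) (\<Prod>i = 0..<q + 1 - p. A (i + p) (\<pi> i + p))"
    if \<pi>: "\<pi> permutes {0..<q + 1 - p}" for \<pi>
  proof -
    have shift: "(\<Sum>i = 0..<q + 1 - p. f (i + p)) = (\<Sum>i = p..q. f i)" for f :: "nat \<Rightarrow> int"
      by (rule sum.reindex_bij_witness [of _ "\<lambda>i. i - p" "\<lambda>i. i + p"]) auto
    have "(\<Sum>i = 0..<q + 1 - p. a (i + p) + b (\<pi> i + p)) =
        (\<Sum>i = 0..<q + 1 - p. a (i + p)) + (\<Sum>i = 0..<q + 1 - p. b (\<pi> i + p))"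
      by (rule sum.distrib)
    also have "(\<Sum>i = 0..<q + 1 - p. b (\<pi> i + p)) = (\<Sum>i = 0..<q + 1 - p. b (i + p))"
      using sum.permute [OF \<pi>, of "\<lambda>i. b (i + p)"] by (simp add: comp_def)
    finally have "(\<Sum>i = 0..<q + 1 - p. a (i + p) + b (\<pi> i + p)) = (\<Sum>i = p..q. a i + b i)"
      by (simp only: shift sum.distrib)
    then show ?thesis
      using homogeneous_prod [of "{0..<q + 1 - p}" "\<lambda>i. a (i + p) + b (\<pi> i + p)"
          "\<lambda>i. A (i + p) (\<pi> i + p)"] assms by simp
  qed
  then show ?thesis
    unfolding block_det_leibniz by (auto intro!: homogeneous_sum homogeneous_of_int_times)
qed

lemma sum_part:
  assumes "length l \<le> N"
  shows "(\<Sum>i = 1..N. part l i) = sum_list l"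
proof -
  have "(\<Sum>i = 1..N. part l i) = (\<Sum>i = 1..length l. part l i)"
    using assms by (intro sum.mono_neutral_right) (auto simp: part_def)
  also have "\<dots> = (\<Sum>i = 0..<length l. l ! i)"
    by (rule sum.reindex_bij_witness [of _ Suc "\<lambda>i. i - 1"]) (auto simp: part_def)
  finally show ?thesis by (simp add: sum_list_sum_nth)
qed

text \<open>Row \<open>k\<close> contributes \<open>k\<close> and column \<open>j\<close>
  contributes \<open>\<lambda>_j - j\<close> to the degree, and the shifts cancel in the
  total.\<close>

lemma homogeneous_schur_fin: "homogeneous (int (sum_list l)) (schur_fin N l)"
proof (cases "length l \<le> N")
  case True
  have "homogeneous (\<Sum>i = 1..N. int i + (int (part l i) - int i))
    (block_det 1 N (\<lambda>k j. complete_sym (int (part l j) - int j + int k) (map xvar [k..<Suc N])))"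
  proof (rule homogeneous_block_det)
    fix k j
    have "homogeneous (int (part l j) - int j + int k)
      (complete_sym (int (part l j) - int j + int k) (map xvar [k..<Suc N]))"
      by (rule homogeneous_complete_sym) (auto simp: xvar_def homogeneous_var)
    then show "homogeneous (int k + (int (part l j) - int j))
      (complete_sym (int (part l j) - int j + int k) (map xvar [k..<Suc N]))"
      by (simp only: add.commute)
  qed
  moreover have "(\<Sum>i = 1..N. int i + (int (part l i) - int i)) = int (sum_list l)"
    using sum_part [OF True] by (simp flip: of_nat_sum)
  ultimately show ?thesis
    by (simp only: schur_fin_eq(1) [OF True])
qed (simp add: schur_fin_def)

lemma finite_partitions: "finite {l. is_partition l \<and> sum_list l = n}"
proof (rule finite_subset)
  show "{l. is_partition l \<and> sum_list l = n} \<subseteq> {l. set l \<subseteq> {..n} \<and> length l \<le> n}"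
  proof
    fix l assume "l \<in> {l. is_partition l \<and> sum_list l = n}"
    then have l: "0 \<notin> set l" "sum_list l = n" by (auto simp: is_partition_def)
    have "set l \<subseteq> {..n}" using l(2) member_le_sum_list by auto
    moreover have "length l \<le> sum_list l" using l(1) by (induction l) auto
    ultimately show "l \<in> {l. set l \<subseteq> {..n} \<and> length l \<le> n}" using l(2) by simp
  qed
  show "finite {l. set l \<subseteq> {..n} \<and> length l \<le> n}" by (rule finite_lists_length_le) simp
qed

subsection \<open>Entries of the dual Schur determinant\<close>

lemma hsym_neg: "k < 0 \<Longrightarrow> hsym k S = 0"
  by (simp add: hsym_def)

lemma esym_neg: "k < 0 \<Longrightarrow> esym k S = 0"
  by (simp add: esym_def)

lemma hsym_0: "hsym 0 S = 1"
proof -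
  have "{M. set_mset M \<subseteq> S \<and> int (size M) = 0} = {{#}}" by auto
  then show ?thesis by (simp add: hsym_def)
qed

lemma esym_0: "finite S \<Longrightarrow> esym 0 S = 1"
proof -
  assume "finite S"
  then have "{T. T \<subseteq> S \<and> int (card T) = 0} = {{}}" by (auto dest: finite_subset)
  then show ?thesis by (simp add: esym_def)
qed

lemma esym_eq_0:
  assumes "finite S" "int (card S) < k"
  shows "esym k S = 0"
proof -
  have "int (card T) \<noteq> k" if "T \<subseteq> S" for T
    using card_mono [OF assms(1) that] assms(2) by simp
  then have "{T. T \<subseteq> S \<and> int (card T) = k} = {}" by blast
  then show ?thesis unfolding esym_def by (simp only: sum.empty)
qed

lemma finite_multisets:
  assumes "finite S"
  shows "finite {M. set_mset M \<subseteq> S \<and> int (size M) = k}"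
proof (rule finite_subset)
  show "{M. set_mset M \<subseteq> S \<and> int (size M) = k} \<subseteq> mset ` {xs. set xs \<subseteq> S \<and> length xs = nat k}"
  proof
    fix M assume M: "M \<in> {M. set_mset M \<subseteq> S \<and> int (size M) = k}"
    obtain xs where "M = mset xs" using ex_mset by metis
    with M show "M \<in> mset ` {xs. set xs \<subseteq> S \<and> length xs = nat k}" by auto
  qed
  show "finite (mset ` {xs. set xs \<subseteq> S \<and> length xs = nat k})"
    using assms by (intro finite_imageI finite_lists_length_eq)
qed

text \<open>A multiset containing \<open>t\<close> loses one copy and may still contain others, so
  the second term keeps \<open>insert t S\<close>, in contrast to
  \<open>esym_insert\<close>.\<close>

lemma hsym_insert:
  assumes "finite S" "t \<notin> S"
  shows "hsym k (insert t S) = hsym k S + avar t * hsym (k - 1) (insert t S)"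
proof -
  let ?A = "{M. set_mset M \<subseteq> S \<and> int (size M) = k}"
  let ?B = "{M. set_mset M \<subseteq> insert t S \<and> int (size M) = k - 1}"
  have split: "{M. set_mset M \<subseteq> insert t S \<and> int (size M) = k} = ?A \<union> add_mset t ` ?B"
  proof (intro equalityI subsetI)
    fix M assume M: "M \<in> {M. set_mset M \<subseteq> insert t S \<and> int (size M) = k}"
    show "M \<in> ?A \<union> add_mset t ` ?B"
    proof (cases "t \<in># M")
      case True
      then obtain M' where "M = add_mset t M'" by (metis mset_add)
      with M show ?thesis by auto
    qed (use M in auto)
  qed auto
  have "hsym k (insert t S) = (\<Sum>M\<in>?A. \<Prod>s\<in>#M. avar s) + (\<Sum>M\<in>add_mset t ` ?B. \<Prod>s\<in>#M. avar s)"
    unfolding hsym_def split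
  proof (rule sum.union_disjoint)
    show "finite ?A" "finite (add_mset t ` ?B)"
      using assms by (intro finite_imageI finite_multisets; simp)+
    show "?A \<inter> add_mset t ` ?B = {}"
    proof (rule equals0I)
      fix M assume M: "M \<in> ?A \<inter> add_mset t ` ?B"
      then obtain M' where "M = add_mset t M'" by blast
      then have "t \<in># M" by simp
      moreover have "set_mset M \<subseteq> S" using M by blast
      ultimately show False using assms(2) by blast
    qed
  qed
  also have "(\<Sum>M\<in>add_mset t ` ?B. \<Prod>s\<in>#M. avar s) = avar t * hsym (k - 1) (insert t S)"
    unfolding hsym_def sum_distrib_left
    by (subst sum.reindex) (simp_all add: inj_on_def)
  finally show ?thesis by (simp add: hsym_def)
qed

lemma esym_insert:
  assumes "finite S" "t \<notin> S"
  shows "esym k (insert t S) = esym k S + avar t * esym (k - 1) S"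
proof -
  let ?A = "{T. T \<subseteq> S \<and> int (card T) = k}" and ?B = "{T. T \<subseteq> S \<and> int (card T) = k - 1}"
  have card: "card (insert t T) = Suc (card T)" if "T \<subseteq> S" for T
    using assms that by (meson card_insert_disjoint finite_subset subsetD)
  have split: "{T. T \<subseteq> insert t S \<and> int (card T) = k} = ?A \<union> insert t ` ?B"
  proof (intro equalityI subsetI)
    fix T assume T: "T \<in> {T. T \<subseteq> insert t S \<and> int (card T) = k}"
    show "T \<in> ?A \<union> insert t ` ?B"
    proof (cases "t \<in> T")
      case True
      then obtain T' where "T = insert t T'" "t \<notin> T'" by (meson mk_disjoint_insert)
      moreover from this have "T' \<subseteq> S" using T by auto
      ultimately show ?thesis using T card by auto
    qed (use T in auto)
  qed (auto simp: card)
  have "esym k (insert t S) = (\<Sum>T\<in>?A. \<Prod>s\<in>T. avar s) + (\<Sum>T\<in>insert t ` ?B. \<Prod>s\<in>T. avar s)"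
    unfolding esym_def split
    by (rule sum.union_disjoint) (use assms in auto)
  also have "(\<Sum>T\<in>insert t ` ?B. \<Prod>s\<in>T. avar s) = (\<Sum>T\<in>?B. \<Prod>s\<in>insert t T. avar s)"
    using assms by (intro sum.reindex_cong [of "insert t"]) (auto simp: inj_on_def)
  also have "\<dots> = avar t * esym (k - 1) S"
    unfolding esym_def sum_distrib_left using assms
    by (intro sum.cong refl prod.insert) (auto dest: finite_subset)
  finally show ?thesis by (simp add: esym_def)
qed

text \<open>Multiplying the generating function of the \<open>h_k\<close> by
  \<open>1 - a_t x_v\<close> removes \<open>t\<close> from the set of variables. This turns the
  quotients in the first \<open>d\<close> columns into explicit series.\<close>

lemma mps_univ_hsym:
  assumes "finite S"
  shows "mps_univ v (\<lambda>k. hsym (int k) S) * (\<Prod>t\<in>S. 1 - mps_const (avar t) * mps_var v) = 1"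
  using assms
proof (induction S rule: finite_induct)
  case empty
  have "hsym (int k) {} = (if k = 0 then 1 else 0)" for k by (cases k) (simp_all add: hsym_def)
  then show ?case by (simp add: mps_univ_delta)
next
  case (insert t S)
  have "hsym (int k) S = (if k = 0 then hsym (int 0) (insert t S)
      else hsym (int k) (insert t S) - avar t * hsym (int (k - 1)) (insert t S))" for k
    using hsym_insert [OF insert.hyps, of "int k"] by (cases k) (simp_all add: hsym_0)
  then have "mps_univ v (\<lambda>k. hsym (int k) (insert t S)) * (1 - mps_const (avar t) * mps_var v) =
      mps_univ v (\<lambda>k. hsym (int k) S)"
    by (simp add: mps_univ_times_one_minus_var)
  with insert show ?case
    by (simp add: mult.assoc [symmetric])
qed

lemma mps_univ_esym:
  assumes "finite S"
  shows "(\<Prod>t\<in>S. 1 - mps_const (avar t) * mps_var v) = mps_univ v (\<lambda>k. (- 1) ^ k * esym (int k) S)"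
  using assms
proof (induction S rule: finite_induct)
  case empty
  have "(- 1) ^ k * esym (int k) {} = (if k = 0 then 1 else 0)" for k
    by (cases k) (simp_all add: esym_0 esym_eq_0)
  then show ?case by (simp add: mps_univ_delta)
next
  case (insert t S)
  have "(- 1) ^ k * esym (int k) (insert t S) = (if k = 0 then (- 1) ^ 0 * esym (int 0) S
      else (- 1) ^ k * esym (int k) S - avar t * ((- 1) ^ (k - 1) * esym (int (k - 1)) S))" for k
    using insert.hyps
    by (cases k) (simp_all add: esym_0 esym_insert esym_neg algebra_simps)
  then show ?case
    using insert by (simp add: mult.commute [of "1 - _"] mps_univ_times_one_minus_var)
qed

text \<open>The coefficient at the power \<open>r\<close> in column \<open>j\<close> after the
  factor with exponent \<open>\<mu>_j + N - j\<close> is removed, hence independent of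
  \<open>N\<close>. For negative \<open>r\<close> the value of \<open>nat r\<close> does not matter,
  since \<open>esym r\<close> is 0.\<close>

definition dual_coeff :: "nat list \<Rightarrow> nat \<Rightarrow> int \<Rightarrow> Qa" where
  "dual_coeff \<mu> j r =
     (if j \<le> diag_boxes \<mu> then hsym r {int j - int (part \<mu> j)..0}
      else (- 1) ^ nat r * esym r {1..int j - int (part \<mu> j) - 1})"

lemma dual_schur_entry_eq:
  assumes "j \<le> N"
  shows "dual_schur_entry N \<mu> i j =
    mps_univ (i - 1) (\<lambda>k. dual_coeff \<mu> j (int k - int N - int (part \<mu> j) + int j))"
proof -
  let ?n = "part \<mu> j + N - j" and ?v = "i - 1"
  \<comment> \<open>Multiplication by a power shifts the sequence; the zeros it inserts are
    accounted for by \<open>g\<close> vanishing at negative integers.\<close>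
  have shift: "xvar i ^ ?n * mps_univ ?v (\<lambda>k. g (int k)) =
      mps_univ ?v (\<lambda>k. g (int k - int N - int (part \<mu> j) + int j))"
    if "\<And>k. k < 0 \<Longrightarrow> g k = 0" for g
    unfolding xvar_def mps_var_power_times_univ
    using that assms
    by (intro arg_cong [where f = "mps_univ ?v"] ext) (auto simp: of_nat_diff algebra_simps)
  show ?thesis
  proof (cases "j \<le> diag_boxes \<mu>")
    case True
    let ?S = "{int j - int (part \<mu> j)..0}"
    let ?P = "\<Prod>t\<in>?S. 1 - mps_const (avar t) * xvar i"
    have "xvar i ^ ?n * mps_univ ?v (\<lambda>k. hsym (int k) ?S) * ?P = xvar i ^ ?n"
      using mps_univ_hsym [of ?S ?v] by (simp add: mult.assoc xvar_def)
    moreover have "nonzerodiv ?P"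
      unfolding xvar_def by (intro nonzerodiv_prod nonzerodiv_one_minus_var)
    ultimately have "dual_schur_entry N \<mu> i j = xvar i ^ ?n * mps_univ ?v (\<lambda>k. hsym (int k) ?S)"
      using True by (simp add: dual_schur_entry_def exact_quot_eqI)
    then show ?thesis
      using True shift [of "\<lambda>r. hsym r ?S"] by (simp add: dual_coeff_def hsym_neg)
  next
    case False
    let ?S = "{1..int j - int (part \<mu> j) - 1}"
    have "dual_schur_entry N \<mu> i j =
        xvar i ^ ?n * mps_univ ?v (\<lambda>k. (- 1) ^ nat (int k) * esym (int k) ?S)"
      using False mps_univ_esym [of ?S ?v] by (simp add: dual_schur_entry_def xvar_def)
    then show ?thesis
      using False shift [of "\<lambda>r. (- 1) ^ nat r * esym r ?S"] by (simp add: dual_coeff_def esym_neg)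
  qed
qed

subsection \<open>The determinant attached to a pair of partitions\<close>

lemma downward_closed_eq_interval:
  assumes "finite S" "\<And>i. i \<in> S \<Longrightarrow> 1 \<le> i" "\<And>i j. j \<in> S \<Longrightarrow> 1 \<le> i \<Longrightarrow> i \<le> j \<Longrightarrow> i \<in> S"
  shows "S = {1..card S}"
proof (cases "S = {}")
  case False
  have "S = {1..Max S}"
  proof (intro equalityI subsetI)
    fix i assume "i \<in> {1..Max S}"
    then show "i \<in> S" using assms(3) [of "Max S" i] assms(1) False by simp
  qed (use assms(1,2) in auto)
  then obtain n where "S = {1..n}" by blast
  then show ?thesis by simp
qed simp

lemma part_eq_0: "length l < i \<Longrightarrow> part l i = 0"
  by (simp add: part_def)

lemma part_pos:
  assumes "is_partition l" "1 \<le> i" "i \<le> length l"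
  shows "0 < part l i"
proof -
  have "l ! (i - 1) \<in> set l" using assms by simp
  with assms(1) have "l ! (i - 1) \<noteq> 0" by (metis is_partition_def)
  with assms show ?thesis by (simp add: part_def)
qed

lemma part_antimono:
  assumes "is_partition l" "1 \<le> i" "i \<le> j"
  shows "part l j \<le> part l i"
proof (cases "i < j \<and> j \<le> length l")
  case True
  moreover have "sorted_wrt (\<ge>) l" using assms(1) by (simp add: is_partition_def)
  ultimately have "l ! (j - 1) \<le> l ! (i - 1)"
    using assms(2) sorted_wrt_nth_less [of "(\<ge>)" l "i - 1" "j - 1"] by auto
  then show ?thesis using True assms by (simp add: part_def)
qed (use assms in \<open>auto simp: part_def\<close>)

text \<open>The lengths agree as well: a longer list would have a positive last part where the other
  has 0.\<close>

lemma partition_eqI: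
  assumes l: "is_partition l" "length l \<le> N" and l': "is_partition l'" "length l' \<le> N"
    and eq: "\<And>i. 1 \<le> i \<Longrightarrow> i \<le> N \<Longrightarrow> part l i = part l' i"
  shows "l = l'"
proof (rule nth_equalityI)
  have "length l \<le> length l'"
    if "is_partition l" "length l \<le> N" "\<And>i. 1 \<le> i \<Longrightarrow> i \<le> N \<Longrightarrow> part l i = part l' i" for l l'
  proof (rule ccontr)
    assume "\<not> length l \<le> length l'"
    then show False
      using part_pos [OF that(1), of "length l"] part_eq_0 [of l' "length l"] that(2)
        that(3) [of "length l"] by simp
  qed
  then show len: "length l = length l'"
    using l l' eq by (metis le_antisym)
  fix i assume "i < length l"
  then show "l ! i = l' ! i"
    using eq [of "Suc i"] l(2) len by (simp add: part_def)
qed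

text \<open>The positive values of \<open>f\<close> occupy an initial segment; cutting there leaves
  no zero parts in the list.\<close>

lemma partition_of_antimono:
  assumes "\<And>i j. 1 \<le> i \<Longrightarrow> i \<le> j \<Longrightarrow> j \<le> N \<Longrightarrow> f j \<le> (f i :: nat)"
  obtains l where "is_partition l" "length l \<le> N" "\<And>i. 1 \<le> i \<Longrightarrow> i \<le> N \<Longrightarrow> part l i = f i"
proof -
  define S where "S = {i \<in> {1..N}. 0 < f i}"
  define n where "n = card S"
  have S: "S = {1..n}"
    unfolding n_def
  proof (rule downward_closed_eq_interval)
    show "i \<in> S" if "j \<in> S" "1 \<le> i" "i \<le> j" for i j
      using that assms [of i j] by (auto simp: S_def)
  qed (auto simp: S_def)
  have iff: "i \<le> n \<longleftrightarrow> 0 < f i" if "1 \<le> i" "i \<le> N" for i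
  proof -
    have "i \<le> n \<longleftrightarrow> i \<in> S" using that by (simp add: S)
    then show ?thesis using that by (simp add: S_def)
  qed
  define l where "l = map f [1..<Suc n]"
  have "S \<subseteq> {1..N}" by (auto simp: S_def)
  then have n: "n \<le> N"
    using card_mono [of "{1..N}" S] by (simp add: n_def)
  have "f i \<noteq> 0" if "1 \<le> i" "i \<le> n" for i
    using iff [of i] that n by simp
  then have "0 \<notin> set l"
    by (force simp: l_def less_Suc_eq_le simp del: upt_Suc)
  moreover have "sorted_wrt (\<ge>) l"
    unfolding sorted_wrt_iff_nth_less
  proof (intro allI impI)
    fix i j assume "i < j" "j < length l"
    then show "l ! j \<le> l ! i"
      using n assms [of "Suc i" "Suc j"] by (simp add: l_def del: upt_Suc)
  qed
  ultimately have "is_partition l"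
    by (simp add: is_partition_def)
  moreover have len: "length l = n" by (simp add: l_def)
  have nth: "l ! (i - 1) = f i" if "1 \<le> i" "i \<le> n" for i
    unfolding l_def using that by (subst nth_map) (simp_all del: upt_Suc)
  have "part l i = f i" if "1 \<le> i" "i \<le> N" for i
  proof (cases "i \<le> n")
    case True
    then show ?thesis using nth [of i] that by (simp add: part_def len)
  next
    case False
    then show ?thesis using iff [OF that] by (simp add: part_def len)
  qed
  ultimately show thesis
    using n len by (intro that [of l]) simp_all
qed

text \<open>The boxes on the diagonal form an initial segment. Every later use of the diagonal
  length goes through this inequality between \<open>i\<close> and the \<open>i\<close>-th
  part.\<close>

lemma le_diag_boxes_iff:
  assumes "is_partition l" "1 \<le> i"
  shows "i \<le> diag_boxes l \<longleftrightarrow> i \<le> part l i"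
proof -
  let ?S = "{i. (i, i) \<in> diagram l}"
  have S: "?S = {1..diag_boxes l}"
    unfolding diag_boxes_def
  proof (rule downward_closed_eq_interval)
    have "?S \<subseteq> {1..length l}" by (auto simp: diagram_def part_def split: if_splits)
    then show "finite ?S" by (rule finite_subset) simp
    show "i \<in> ?S" if "j \<in> ?S" "1 \<le> i" "i \<le> j" for i j
      using that part_antimono [OF assms(1), of i j] by (auto simp: diagram_def)
  qed (simp add: diagram_def)
  have "i \<le> diag_boxes l \<longleftrightarrow> i \<in> {1..diag_boxes l}" using assms(2) by simp
  also have "\<dots> \<longleftrightarrow> i \<le> part l i"
    unfolding S [symmetric] using assms(2) by (simp add: diagram_def)
  finally show ?thesis .
qed

lemma diag_boxes_le_length:
  assumes "is_partition l"
  shows "diag_boxes l \<le> length l"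
proof (rule ccontr)
  assume "\<not> diag_boxes l \<le> length l"
  then show False
    using le_diag_boxes_iff [OF assms, of "diag_boxes l"] part_eq_0 [of l "diag_boxes l"] by simp
qed

lemma diagram_subset_iff: "diagram m \<subseteq> diagram l \<longleftrightarrow> (\<forall>i\<ge>1. part m i \<le> part l i)"
proof
  assume sub: "diagram m \<subseteq> diagram l"
  show "\<forall>i\<ge>1. part m i \<le> part l i"
  proof (intro allI impI)
    fix i :: nat assume "1 \<le> i"
    show "part m i \<le> part l i"
    proof (cases "part m i = 0")
      case False
      with \<open>1 \<le> i\<close> have "(i, part m i) \<in> diagram m" by (simp add: diagram_def)
      with sub have "(i, part m i) \<in> diagram l" by blast
      then show ?thesis by (simp add: diagram_def)
    qed simp
  qed
qed (auto simp: diagram_def intro: order_trans)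

lemma length_mono:
  assumes "is_partition m" "diagram m \<subseteq> diagram l"
  shows "length m \<le> length l"
proof (rule ccontr)
  assume "\<not> length m \<le> length l"
  then have "1 \<le> length m" "length l < length m" by auto
  moreover from this have "part m (length m) \<le> part l (length m)"
    using assms(2) unfolding diagram_subset_iff by blast
  ultimately show False
    using part_pos [OF assms(1), of "length m"] part_eq_0 [of l "length m"] by simp
qed

text \<open>Rows beyond \<open>length l\<close> contribute nothing, so the sum can match
  determinants of size \<open>N\<close>.\<close>

lemma lower_boxes_eq_sum:
  assumes "length l \<le> N" "diagram m \<subseteq> diagram l"
  shows "lower_boxes d l m = (\<Sum>i = d + 1..N. part l i - part m i)"
proof -
  have "{(r, c) \<in> diagram l - diagram m. d + 1 \<le> r \<and> r \<le> length l} =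
      Sigma {d + 1..length l} (\<lambda>r. {part m r<..part l r})"
    by (auto simp: diagram_def)
  then have "lower_boxes d l m = (\<Sum>i = d + 1..length l. part l i - part m i)"
    by (simp add: lower_boxes_def)
  also have "\<dots> = (\<Sum>i = d + 1..N. part l i - part m i)"
    using assms(1) by (intro sum.mono_neutral_left) (auto simp: part_eq_0)
  finally show ?thesis .
qed

lemma minus_one_power_add_even: "a = b + 2 * c \<Longrightarrow> (- 1) ^ a = (- 1 :: 'a::comm_ring_1) ^ b"
  by (simp add: power_add power_mult)

section \<open>Evaluation of the coefficient determinant\<close>

context
  fixes \<mu> l :: "nat list" and N :: nat
  assumes \<mu>: "is_partition \<mu>" "length \<mu> \<le> N" and l: "is_partition l" "length l \<le> N"
begin

abbreviation (input) "idx i j \<equiv> int (part l i) - int (part \<mu> j) - int i + int j"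
abbreviation (input) "hset j \<equiv> {int j - int (part \<mu> j)..0}"
abbreviation (input) "eset j \<equiv> {1..int j - int (part \<mu> j) - 1}"

lemma dual_coeff_neg: "r < 0 \<Longrightarrow> dual_coeff \<mu> j r = 0"
  by (simp add: dual_coeff_def hsym_neg esym_neg)

text \<open>Here \<open>\<lambda>_i \<ge> i\<close>, so the index of \<open>e\<close> exceeds its
  number of variables.\<close>

lemma dual_coeff_upper_right:
  assumes "1 \<le> i" "i \<le> diag_boxes l" "diag_boxes \<mu> < j"
  shows "dual_coeff \<mu> j (idx i j) = 0"
proof -
  have "i \<le> part l i" "part \<mu> j < j"
    using assms le_diag_boxes_iff [OF l(1), of i] le_diag_boxes_iff [OF \<mu>(1), of j] by auto
  then have "int (card (eset j)) < idx i j" by simp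
  then show ?thesis using assms by (simp add: dual_coeff_def esym_eq_0)
qed

text \<open>From \<open>\<lambda>_i < i\<close> and \<open>j \<le> \<mu>_j\<close> the index is
  negative.\<close>

lemma dual_coeff_lower_left:
  assumes "diag_boxes l < i" "1 \<le> j" "j \<le> diag_boxes \<mu>"
  shows "dual_coeff \<mu> j (idx i j) = 0"
proof -
  have "part l i < i" "j \<le> part \<mu> j"
    using assms le_diag_boxes_iff [OF l(1), of i] le_diag_boxes_iff [OF \<mu>(1), of j] by auto
  then show ?thesis by (intro dual_coeff_neg) simp
qed

text \<open>If the diagonal lengths differ, the upper right or the lower left zero block has sides
  adding up to more than \<open>N\<close>. If \<open>\<lambda>_k < \<mu>_k\<close>, the indices in
  rows \<open>k..N\<close> and columns \<open>1..k\<close> are at most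
  \<open>\<lambda>_k - \<mu>_k < 0\<close>, and the sides add up to \<open>N + 1\<close>.\<close>

lemma dual_det_eq_0:
  assumes "\<not> (diagram \<mu> \<subseteq> diagram l \<and> diag_boxes l = diag_boxes \<mu>)"
  shows "block_det 1 N (\<lambda>i j. dual_coeff \<mu> j (idx i j)) = 0"
proof -
  let ?d = "diag_boxes l" and ?e = "diag_boxes \<mu>"
  have le: "?d \<le> N" "?e \<le> N"
    using diag_boxes_le_length [OF l(1)] diag_boxes_le_length [OF \<mu>(1)] l(2) \<mu>(2) by simp_all
  consider "?e < ?d" | "?d < ?e" | "\<not> diagram \<mu> \<subseteq> diagram l" using assms by linarith
  then show ?thesis
  proof cases
    case 1
    with le show ?thesis
      by (intro block_det_zero_rectangle [where R = "{1..?d}" and C = "{?e + 1..N}"])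
        (auto intro!: dual_coeff_upper_right)
  next
    case 2
    with le show ?thesis
      by (intro block_det_zero_rectangle [where R = "{?d + 1..N}" and C = "{1..?e}"])
        (auto intro!: dual_coeff_lower_left)
  next
    case 3
    then obtain k where k: "1 \<le> k" "part l k < part \<mu> k"
      unfolding diagram_subset_iff by force
    then have "k \<le> N" using part_eq_0 [of \<mu> k] \<mu>(2) by (cases "k \<le> length \<mu>") auto
    moreover have "dual_coeff \<mu> j (idx i j) = 0" if "k \<le> i" "1 \<le> j" "j \<le> k" for i j
      using part_antimono [OF l(1) k(1) that(1)] part_antimono [OF \<mu>(1) that(2,3)] k that
      by (intro dual_coeff_neg) linarith
    ultimately show ?thesis
      using k by (intro block_det_zero_rectangle [where R = "{k..N}" and C = "{1..k}"]) auto
  qed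
qed

text \<open>In a row beyond \<open>length l\<close> both partitions have part 0, so the diagonal
  entry is \<open>e_0 = 1\<close>, while the entries to its left have negative index.\<close>

lemma esym_det_extend:
  assumes "length \<mu> \<le> length l" "d \<le> length l"
  shows "block_det (d + 1) N (\<lambda>i j. esym (idx i j) (eset j)) =
    block_det (d + 1) (length l) (\<lambda>i j. esym (idx i j) (eset j))"
  using l(2)
proof (induction N rule: dec_induct)
  case (step n)
  have "block_det (d + 1) (Suc n) (\<lambda>i j. esym (idx i j) (eset j)) =
      block_det (d + 1) n (\<lambda>i j. esym (idx i j) (eset j)) * esym (idx (Suc n) (Suc n)) (eset (Suc n))"
    using step assms by (intro block_det_last_row esym_neg) (auto simp: part_eq_0)
  also have "esym (idx (Suc n) (Suc n)) (eset (Suc n)) = 1"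
    using step assms by (simp add: part_eq_0 esym_0)
  finally show ?case using step.IH by simp
qed simp

lemma dual_det_eq:
  assumes sub: "diagram \<mu> \<subseteq> diagram l" and d: "diag_boxes l = d" "diag_boxes \<mu> = d"
  shows "block_det 1 N (\<lambda>i j. dual_coeff \<mu> j (idx i j)) =
    (- 1) ^ lower_boxes d l \<mu> * block_det 1 d (\<lambda>i j. hsym (idx i j) (hset j)) *
    block_det (d + 1) (length l) (\<lambda>i j. esym (idx i j) (eset j))"
proof -
  have dl: "d \<le> length l" using diag_boxes_le_length l(1) d by blast
  have part_le: "part \<mu> i \<le> part l i" if "1 \<le> i" for i
    using sub that by (simp add: diagram_subset_iff)
  have "block_det 1 N (\<lambda>i j. dual_coeff \<mu> j (idx i j)) =
      block_det 1 d (\<lambda>i j. dual_coeff \<mu> j (idx i j)) *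
      block_det (Suc d) N (\<lambda>i j. dual_coeff \<mu> j (idx i j))"
    using dl l(2) d by (intro block_det_split dual_coeff_upper_right) auto
  also have "block_det 1 d (\<lambda>i j. dual_coeff \<mu> j (idx i j)) =
      block_det 1 d (\<lambda>i j. hsym (idx i j) (hset j))"
    using d by (intro block_det_cong) (simp add: dual_coeff_def)
  \<comment> \<open>The sign exponent \<open>\<lambda>_i - \<mu>_j - i + j\<close> has the parity of
    \<open>(\<lambda>_i + i) + (\<mu>_j + j)\<close>, a row term plus a column term. For a negative
    index both sides vanish.\<close>
  also have "block_det (Suc d) N (\<lambda>i j. dual_coeff \<mu> j (idx i j)) =
      block_det (Suc d) N (\<lambda>i j. (- 1) ^ (part l i + i) * (- 1) ^ (part \<mu> j + j) *
        esym (idx i j) (eset j))"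
  proof (rule block_det_cong)
    fix i j assume j: "Suc d \<le> j"
    show "dual_coeff \<mu> j (idx i j) =
      (- 1) ^ (part l i + i) * (- 1) ^ (part \<mu> j + j) * esym (idx i j) (eset j)"
    proof (cases "idx i j < 0")
      case False
      then have "part l i + j = nat (idx i j) + i + part \<mu> j" by linarith
      then have "(part l i + i) + (part \<mu> j + j) = nat (idx i j) + 2 * (i + part \<mu> j)" by simp
      then have "(- 1 :: Qa) ^ (part l i + i) * (- 1) ^ (part \<mu> j + j) = (- 1) ^ nat (idx i j)"
        unfolding power_add [symmetric] by (rule minus_one_power_add_even)
      then show ?thesis using j d by (simp add: dual_coeff_def)
    qed (simp add: dual_coeff_neg esym_neg)
  qed
  also have "\<dots> = (\<Prod>i = Suc d..N. (- 1) ^ (part l i + i) * (- 1) ^ (part \<mu> i + i)) *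
      block_det (Suc d) N (\<lambda>i j. esym (idx i j) (eset j))"
    by (rule block_det_scale)
  also have "(\<Prod>i = Suc d..N. (- 1) ^ (part l i + i) * (- 1) ^ (part \<mu> i + i)) =
      (\<Prod>i = Suc d..N. (- 1 :: Qa) ^ (part l i - part \<mu> i))"
  proof (rule prod.cong)
    fix i assume "i \<in> {Suc d..N}"
    then have "(part l i + i) + (part \<mu> i + i) = (part l i - part \<mu> i) + 2 * (part \<mu> i + i)"
      using part_le [of i] by simp
    then show "(- 1) ^ (part l i + i) * (- 1) ^ (part \<mu> i + i) = (- 1 :: Qa) ^ (part l i - part \<mu> i)"
      unfolding power_add [symmetric] by (rule minus_one_power_add_even)
  qed simp
  also have "\<dots> = (- 1) ^ lower_boxes d l \<mu>"
    using lower_boxes_eq_sum [OF l(2) sub, of d] by (simp add: power_sum)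
  finally show ?thesis
    using esym_det_extend [OF length_mono [OF \<mu>(1) sub] dl] by (simp add: mult_ac)
qed

end

subsection \<open>Expansion into Schur functions\<close>

lemma strict_decreasing_eqI:
  fixes p q :: "nat \<Rightarrow> nat"
  assumes p: "\<And>i j. 1 \<le> i \<Longrightarrow> i < j \<Longrightarrow> j \<le> N \<Longrightarrow> p j < p i"
    and q: "\<And>i j. 1 \<le> i \<Longrightarrow> i < j \<Longrightarrow> j \<le> N \<Longrightarrow> q j < q i"
    and img: "p ` {1..N} = q ` {1..N}" and i: "1 \<le> i" "i \<le> N"
  shows "p i = q i"
proof -
  have sorted: "sorted_wrt (<) (rev (map p [1..<Suc N]))"
    if "\<And>i j. 1 \<le> i \<Longrightarrow> i < j \<Longrightarrow> j \<le> N \<Longrightarrow> p j < p i" for p :: "nat \<Rightarrow> nat"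
    unfolding sorted_wrt_rev unfolding sorted_wrt_iff_nth_less
  proof (intro allI impI)
    fix i j assume "i < j" "j < length (map p [1..<Suc N])"
    then show "map p [1..<Suc N] ! j < map p [1..<Suc N] ! i"
      using that [of "Suc i" "Suc j"] by (simp del: upt_Suc)
  qed
  have "set (rev (map p [1..<Suc N])) = set (rev (map q [1..<Suc N]))"
    using img by (simp add: atLeastLessThanSuc_atLeastAtMost del: upt_Suc)
  moreover have "sorted_wrt (<) (rev (map p [1..<Suc N]))" by (rule sorted) (rule p)
  moreover have "sorted_wrt (<) (rev (map q [1..<Suc N]))" by (rule sorted) (rule q)
  ultimately have "rev (map p [1..<Suc N]) = rev (map q [1..<Suc N])"
    by (intro strict_sorted_equal)
  then have "\<forall>i\<in>set [1..<Suc N]. p i = q i" by (simp del: upt_Suc)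
  then show ?thesis using i by (simp del: upt_Suc)
qed

lemma strict_decreasing_enumeration:
  assumes "finite S" "card S = N"
  obtains g :: "nat \<Rightarrow> nat" where "g ` {1..N} = S"
    and "\<And>i j. 1 \<le> i \<Longrightarrow> i < j \<Longrightarrow> j \<le> N \<Longrightarrow> g j < g i"
proof -
  define ys where "ys = sorted_list_of_set S"
  have ys: "sorted_wrt (<) ys" "set ys = S" "length ys = N"
    using assms by (auto simp: ys_def)
  define g where "g i = ys ! (N - i)" for i
  show thesis
  proof
    show "g ` {1..N} = S"
    proof -
      have "g ` {1..N} = (!) ys ` {0..<N}"
      proof (intro equalityI subsetI)
        fix x assume "x \<in> (!) ys ` {0..<N}"
        then obtain k where "k < N" "x = ys ! k" by auto
        then show "x \<in> g ` {1..N}"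
          by (intro image_eqI [of _ _ "N - k"]) (auto simp: g_def)
      qed (auto simp: g_def)
      also have "\<dots> = S" using ys by (metis list.set_map map_nth set_upt)
      finally show ?thesis .
    qed
    fix i j assume "1 \<le> i" "i < j" "j \<le> N"
    then show "g j < g i"
      unfolding g_def by (intro sorted_wrt_nth_less [OF ys(1)]) (auto simp: ys)
  qed
qed

text \<open>Adding the staircase \<open>(N - 1, ..., 0)\<close> makes the parts distinct, so
  partitions with at most \<open>N\<close> parts correspond to sets of \<open>N\<close>
  exponents.\<close>

definition shifted_part :: "nat \<Rightarrow> nat list \<Rightarrow> nat \<Rightarrow> nat" where
  "shifted_part N l j = part l j + N - j"

lemma shifted_part_less:
  assumes "is_partition l" "1 \<le> i" "i < j" "j \<le> N"
  shows "shifted_part N l j < shifted_part N l i"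
  using part_antimono [OF assms(1), of i j] assms by (simp add: shifted_part_def)

lemma inj_on_shifted_part: "is_partition l \<Longrightarrow> inj_on (shifted_part N l) {1..N}"
  by (rule linorder_inj_onI') (metis atLeastAtMost_iff nat_neq_iff shifted_part_less)

lemma partition_eq_of_shifted_image:
  assumes l: "is_partition l" "length l \<le> N" and l': "is_partition l'" "length l' \<le> N"
    and img: "shifted_part N l ` {1..N} = shifted_part N l' ` {1..N}"
  shows "l = l'"
proof (rule partition_eqI [OF l l'])
  fix i assume i: "1 \<le> i" "i \<le> N"
  have "shifted_part N l i = shifted_part N l' i"
    using shifted_part_less [OF l(1)] shifted_part_less [OF l'(1)] img i
    by (rule strict_decreasing_eqI)
  then show "part l i = part l' i"
    using i by (simp add: shifted_part_def)
qed

text \<open>The values of \<open>p\<close> are listed in decreasing order as \<open>g\<close>, and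
  the staircase is subtracted.\<close>

lemma partition_of_image:
  assumes "inj_on p {1..N}"
  obtains l where "is_partition l" "length l \<le> N" "shifted_part N l ` {1..N} = p ` {1..N}"
proof -
  have "card (p ` {1..N}) = N" using assms by (simp add: card_image)
  then obtain g where g: "g ` {1..N} = p ` {1..N}"
    and dec: "\<And>i j. 1 \<le> i \<Longrightarrow> i < j \<Longrightarrow> j \<le> N \<Longrightarrow> g j < g i"
    by (metis finite_imageI finite_atLeastAtMost strict_decreasing_enumeration)
  \<comment> \<open>Each step drops by at least 1. This gives both \<open>N - j \<le> g j\<close>,
    so that the subtraction on naturals is not cut off, and the monotonicity of the
    differences.\<close>
  have step: "g j + (j - i) \<le> g i" if "i \<le> j" "1 \<le> i" "j \<le> N" for i j
    using that
  proof (induction j rule: dec_induct)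
    case (step k)
    then show ?case using dec [of k "Suc k"] by simp
  qed simp
  have ge: "N - j \<le> g j" if "1 \<le> j" "j \<le> N" for j
    using step [of j N] that by simp
  have antimono: "g j - (N - j) \<le> g i - (N - i)" if "1 \<le> i" "i \<le> j" "j \<le> N" for i j
    using step [of i j] ge [of i] that by simp
  obtain l where l: "is_partition l" "length l \<le> N"
    and part: "\<And>i. 1 \<le> i \<Longrightarrow> i \<le> N \<Longrightarrow> part l i = g i - (N - i)"
    using partition_of_antimono [of N "\<lambda>i. g i - (N - i)", OF antimono] by blast
  have "shifted_part N l i = g i" if "1 \<le> i" "i \<le> N" for i
    using ge [OF that] part [OF that] that by (simp add: shifted_part_def)
  then have "shifted_part N l ` {1..N} = g ` {1..N}" by (intro image_cong) auto
  with l g show thesis by (intro that) auto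
qed

lemma permutation_of_images:
  assumes "inj_on p A" "inj_on q A" "p ` A = q ` A"
  obtains \<sigma> where "\<sigma> permutes A" "\<And>i. i \<in> A \<Longrightarrow> p i = q (\<sigma> i)"
proof -
  define \<sigma> where "\<sigma> i = (if i \<in> A then inv_into A q (p i) else i)" for i
  have eq: "\<sigma> i \<in> A" "q (\<sigma> i) = p i" if "i \<in> A" for i
    using that assms(3) by (auto simp: \<sigma>_def intro!: inv_into_into f_inv_into_f)
  have "inj_on \<sigma> A"
    using eq assms(1) by (metis inj_on_def)
  moreover have "\<sigma> ` A = A"
  proof (intro equalityI subsetI)
    fix j assume j: "j \<in> A"
    then obtain i where "i \<in> A" "p i = q j" using assms(3) by (metis imageE imageI)
    then show "j \<in> \<sigma> ` A"
      using eq [of i] j assms(2) by (metis image_eqI inj_onD)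
  qed (use eq in auto)
  ultimately have "\<sigma> permutes A"
    by (intro bij_imp_permutes bij_betw_imageI) (auto simp: \<sigma>_def)
  then show thesis using eq by (intro that) auto
qed

lemma block_det_delta:
  assumes "inj_on q {1..N}"
  shows "block_det 1 N (\<lambda>i j. if q i = q j then 1 else 0) = 1"
proof -
  have "block_det 1 N (\<lambda>i j. if q i = q j then 1 else 0) =
      (\<Prod>i = 1..N. if q i = q i then 1 else 0)"
    by (intro block_det_upper_triangular) (auto simp: inj_on_eq_iff [OF assms])
  then show ?thesis by simp
qed

text \<open>A monomial with distinct exponents occurs, up to sign, in the alternant of exactly one
  partition, namely the one obtained by sorting the exponents; all other coefficients vanish.\<close>

lemma alternant_expansion:
  fixes c :: "nat \<Rightarrow> nat \<Rightarrow> Qa"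
  shows "mps_has_sum
    (\<lambda>l. mps_const (block_det 1 N (\<lambda>i j. c j (shifted_part N l i))) *
      block_det 1 N (\<lambda>i j. xvar i ^ shifted_part N l j))
    {l. is_partition l \<and> length l \<le> N}
    (block_det 1 N (\<lambda>i j. mps_univ (i - 1) (c j)))"
    (is "mps_has_sum ?f ?I ?g")
proof (rule mps_has_sumI)
  fix m :: "nat \<Rightarrow>\<^sub>0 nat"
  define p where "p i = Poly_Mapping.lookup m (i - 1)" for i
  let ?q = "shifted_part N"
  \<comment> \<open>At most one partition has the exponents of \<open>m\<close> as its shifted
    parts.\<close>
  define J where "J = {l \<in> ?I. p ` {1..N} = ?q l ` {1..N}}"
  have unique: "l = l'" if "l \<in> J" "l' \<in> J" for l l'
    using that partition_eq_of_shifted_image [of l N l'] by (auto simp: J_def)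
  have "J = {} \<or> (\<exists>l. J = {l})"
    using unique by blast
  then show "finite J" by auto
  show "J \<subseteq> ?I" by (auto simp: J_def)
  have alternant: "mps_coeff (block_det 1 N (\<lambda>i j. xvar i ^ ?q l j)) m =
      (if Poly_Mapping.keys m \<subseteq> {..<N} then block_det 1 N (\<lambda>i j. if p i = ?q l j then 1 else 0)
       else 0)" for l
    unfolding xvar_def mps_univ_power
    by (subst mps_coeff_block_det_univ [where c = "\<lambda>j k. if k = ?q l j then 1 else 0"])
      (simp add: p_def)
  have g: "mps_coeff ?g m =
      (if Poly_Mapping.keys m \<subseteq> {..<N} then block_det 1 N (\<lambda>i j. c j (p i)) else 0)"
    by (simp only: mps_coeff_block_det_univ p_def)
  show "mps_coeff (?f l) m = 0" if "l \<in> ?I" "l \<notin> J" for l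
  proof -
    \<comment> \<open>If the two sets of exponents differ, some row or some column of this 0/1
      matrix is zero.\<close>
    have "block_det 1 N (\<lambda>i j. if p i = ?q l j then 1 else 0 :: Qa) = 0"
    proof (cases "p ` {1..N} \<subseteq> ?q l ` {1..N}")
      case False
      then obtain i where "i \<in> {1..N}" "p i \<notin> ?q l ` {1..N}" by blast
      then show ?thesis
        by (intro block_det_zero_rectangle [where R = "{i}" and C = "{1..N}"]) auto
    next
      case True
      with that have "\<not> ?q l ` {1..N} \<subseteq> p ` {1..N}" unfolding J_def by blast
      then obtain j where "j \<in> {1..N}" "?q l j \<notin> p ` {1..N}" by blast
      then show ?thesis
        by (intro block_det_zero_rectangle [where R = "{1..N}" and C = "{j}"]) force+
    qed
    then show ?thesis by (simp only: mps_coeff_const_times alternant) simp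
  qed
  show "mps_coeff ?g m = (\<Sum>l\<in>J. mps_coeff (?f l) m)"
  proof (cases "Poly_Mapping.keys m \<subseteq> {..<N}")
    case False
    then show ?thesis by (simp only: g mps_coeff_const_times alternant) simp
  next
    case keys: True
    show ?thesis
    proof (cases "inj_on p {1..N}")
      case False
      then obtain i k where ik: "i \<in> {1..N}" "k \<in> {1..N}" "i \<noteq> k" "p i = p k"
        by (auto simp: inj_on_def)
      then have "block_det 1 N (\<lambda>i j. c j (p i)) = 0"
        by (intro block_det_identical_rows [of i k]) auto
      moreover have "J = {}"
      proof -
        \<comment> \<open>The shifted parts are \<open>N\<close> distinct numbers; a non-injective
          \<open>p\<close> takes fewer values.\<close>
        have "p ` {1..N} \<noteq> ?q l ` {1..N}" if "is_partition l" for l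
          using False inj_on_shifted_part [OF that, of N]
          by (metis card_image eq_card_imp_inj_on finite_atLeastAtMost)
        then show ?thesis unfolding J_def by blast
      qed
      ultimately show ?thesis by (simp only: g sum.empty) simp
    next
      case True
      then obtain l where l: "is_partition l" "length l \<le> N" "?q l ` {1..N} = p ` {1..N}"
        by (rule partition_of_image)
      then have "l \<in> J" by (simp add: J_def)
      then have Jl: "J = {l}" using unique by blast
      obtain \<sigma> where \<sigma>: "\<sigma> permutes {1..N}" "\<And>i. i \<in> {1..N} \<Longrightarrow> p i = ?q l (\<sigma> i)"
        using True inj_on_shifted_part [OF l(1), of N] l(3) [symmetric]
        by (rule permutation_of_images) blast
      \<comment> \<open>The matrix is the permutation matrix of \<sigma>; its sign is matched below
        by the one from reordering the rows of the determinant of the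
        \<open>c j (p i)\<close>.\<close>
      have "block_det 1 N (\<lambda>i j. if p i = ?q l j then 1 else 0 :: Qa) =
          block_det 1 N (\<lambda>i j. if ?q l (\<sigma> i) = ?q l j then 1 else 0)"
        using \<sigma>(2) by (intro block_det_cong) simp
      also have "\<dots> = of_int (sign \<sigma>)"
        using block_det_permute_rows [OF \<sigma>(1), of "\<lambda>i j. if ?q l i = ?q l j then 1 else 0 :: Qa"]
          block_det_delta [OF inj_on_shifted_part [OF l(1)], of N] by simp
      finally have alt: "mps_coeff (block_det 1 N (\<lambda>i j. xvar i ^ ?q l j)) m = of_int (sign \<sigma>)"
        using keys by (simp only: alternant) simp
      have "mps_coeff ?g m = block_det 1 N (\<lambda>i j. c j (?q l (\<sigma> i)))"
        using keys \<sigma>(2) by (simp only: g) (auto intro: block_det_cong)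
      also have "\<dots> = of_int (sign \<sigma>) * block_det 1 N (\<lambda>i j. c j (?q l i))"
        by (rule block_det_permute_rows [OF \<sigma>(1)])
      finally have "mps_coeff ?g m = mps_coeff (?f l) m"
        by (simp only: mps_coeff_const_times alt) (simp only: mult.commute)
      then show ?thesis by (simp only: Jl) simp
    qed
  qed
qed

section \<open>Summability and comparison of the two expansions\<close>

lemma mps_has_sum_cong_neutral:
  assumes "mps_has_sum f I g"
    and "\<And>i. i \<in> I \<inter> I' \<Longrightarrow> f i = f' i"
    and "\<And>i. i \<in> I - I' \<Longrightarrow> f i = 0" and "\<And>i. i \<in> I' - I \<Longrightarrow> f' i = 0"
  shows "mps_has_sum f' I' g"
proof -
  have eq: "{i \<in> I'. mps_coeff (f' i) m \<noteq> 0} = {i \<in> I. mps_coeff (f i) m \<noteq> 0}" for m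
    using assms(2-4) by (auto, metis DiffI IntI mps_coeff_zero, metis DiffI IntI mps_coeff_zero,
      metis DiffI IntI mps_coeff_zero, metis DiffI IntI mps_coeff_zero)
  show ?thesis
    using assms(1) unfolding mps_has_sum_def eq
  proof (intro allI conjI)
    fix m
    assume *: "\<forall>m. finite {i \<in> I. mps_coeff (f i) m \<noteq> 0} \<and>
      mps_coeff g m = (\<Sum>i | i \<in> I \<and> mps_coeff (f i) m \<noteq> 0. mps_coeff (f i) m)"
    then show "finite {i \<in> I. mps_coeff (f i) m \<noteq> 0}" by blast
    have "mps_coeff (f' i) m = mps_coeff (f i) m" if "i \<in> I" "mps_coeff (f i) m \<noteq> 0" for i
      using that assms(2,3) by (metis DiffI IntI mps_coeff_zero)
    then show "mps_coeff g m = (\<Sum>i | i \<in> I \<and> mps_coeff (f i) m \<noteq> 0. mps_coeff (f' i) m)"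
      using * by simp
  qed
qed

lemma mps_has_sum_set_zero_above:
  assumes "mps_has_sum f I g"
  shows "mps_has_sum (\<lambda>i. set_zero_above N (f i)) I (set_zero_above N g)"
  unfolding mps_has_sum_def
proof
  fix m
  show "finite {i \<in> I. mps_coeff (set_zero_above N (f i)) m \<noteq> 0} \<and>
    mps_coeff (set_zero_above N g) m =
      (\<Sum>i | i \<in> I \<and> mps_coeff (set_zero_above N (f i)) m \<noteq> 0. mps_coeff (set_zero_above N (f i)) m)"
    using assms by (cases "Poly_Mapping.keys m \<subseteq> {..<N}") (auto simp: mps_has_sum_def set_zero_above.rep_eq)
qed

lemma set_zero_above_const_times: "set_zero_above N (mps_const c * f) = mps_const c * set_zero_above N f"
  by (rule mps_eqI) (simp add: set_zero_above.rep_eq)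

text \<open>Homogeneity lets a monomial of degree \<open>n\<close> receive contributions only from
  the finitely many partitions of \<open>n\<close>, whatever the coefficients are.\<close>

lemma schur_combination_summable:
  assumes "\<And>l. l \<in> I \<Longrightarrow> is_partition l"
  obtains f where "mps_has_sum (\<lambda>l. mps_const (c l) * schur l) I f"
proof -
  define J where "J m = I \<inter> {l. is_partition l \<and> sum_list l = mdeg m}" for m :: "nat \<Rightarrow>\<^sub>0 nat"
  define f where "f = Abs_mps (\<lambda>m. \<Sum>l\<in>J m. mps_coeff (mps_const (c l) * schur l) m)"
  have "mps_has_sum (\<lambda>l. mps_const (c l) * schur l) I f"
  proof (rule mps_has_sumI)
    fix m
    show "finite (J m)" "J m \<subseteq> I" by (auto simp: J_def finite_partitions)
    show "mps_coeff f m = (\<Sum>l\<in>J m. mps_coeff (mps_const (c l) * schur l) m)"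
      by (simp add: f_def Abs_mps_inverse)
    fix l assume l: "l \<in> I" "l \<notin> J m"
    obtain N where N: "Poly_Mapping.keys m \<subseteq> {..<N}"
      using finite_nat_bounded [OF finite_keys [of m]] by blast
    have "mps_coeff (schur l) m = mps_coeff (set_zero_above N (schur l)) m"
      using N by (simp add: set_zero_above.rep_eq)
    also have "\<dots> = mps_coeff (schur_fin N l) m"
      using l(1) assms by (simp add: set_zero_above_schur)
    also have "\<dots> = 0"
      using homogeneous_schur_fin [of l N] l assms by (auto simp: homogeneous_def J_def)
    finally show "mps_coeff (mps_const (c l) * schur l) m = 0" by simp
  qed
  then show thesis by (rule that)
qed

theorem proposition3p12:
  fixes \<mu> :: "nat list" and d :: nat
  assumes "is_partition \<mu>" and "d = diag_boxes \<mu>"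
  shows "mps_has_sum
    (\<lambda>l. mps_const ((- 1) ^ lower_boxes d l \<mu>
        * block_det 1 d (\<lambda>i j.
            hsym (int (part l i) - int (part \<mu> j) - int i + int j) {int j - int (part \<mu> j)..0})
        * block_det (d + 1) (length l) (\<lambda>i j.
            esym (int (part l i) - int (part \<mu> j) - int i + int j) {1..int j - int (part \<mu> j) - 1}))
      * schur l)
    {l. is_partition l \<and> diagram \<mu> \<subseteq> diagram l \<and> diag_boxes l = d}
    (dual_schur \<mu>)"
proof -
  define C where "C l = (- 1) ^ lower_boxes d l \<mu>
        * block_det 1 d (\<lambda>i j.
            hsym (int (part l i) - int (part \<mu> j) - int i + int j) {int j - int (part \<mu> j)..0})
        * block_det (d + 1) (length l) (\<lambda>i j.
            esym (int (part l i) - int (part \<mu> j) - int i + int j) {1..int j - int (part \<mu> j) - 1})"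
    for l
  let ?I = "{l. is_partition l \<and> diagram \<mu> \<subseteq> diagram l \<and> diag_boxes l = d}"
  obtain f where f: "mps_has_sum (\<lambda>l. mps_const (C l) * schur l) ?I f"
    by (rule schur_combination_summable [of ?I C]) auto
  have "set_zero_above N f = dual_schur_fin N \<mu>" for N
  proof -
    let ?f = "\<lambda>l. mps_const (C l) * schur_fin N l"
    have "mps_has_sum (\<lambda>l. set_zero_above N (mps_const (C l) * schur l)) ?I (set_zero_above N f)"
      using f by (rule mps_has_sum_set_zero_above)
    then have fin: "mps_has_sum ?f ?I (set_zero_above N f)"
      by (rule mps_has_sum_cong_neutral) (auto simp: set_zero_above_const_times set_zero_above_schur)
    show ?thesis
    proof (cases "length \<mu> \<le> N")
      case False
      \<comment> \<open>Every \<lambda> containing \<mu> has more than \<open>N\<close> parts too,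
        in agreement with the default value 0 of \<open>dual_schur_fin\<close>.\<close>
      then have "schur_fin N l = 0" if "l \<in> ?I" for l
        using length_mono [OF assms(1), of l] that by (simp add: schur_fin_def)
      then have "mps_coeff (set_zero_above N f) m = 0" for m
        using mps_has_sumD [OF fin, of "{}" m] by simp
      then show ?thesis
        using False by (intro mps_eqI) (simp add: dual_schur_fin_def)
    next
      case True
      define c where "c j k = dual_coeff \<mu> j (int k - int N - int (part \<mu> j) + int j)" for j k
      \<comment> \<open>At the exponent \<open>\<lambda>_i + N - i\<close> the number
        \<open>N\<close> cancels from the index.\<close>
      have entry: "c j (shifted_part N l i) =
          dual_coeff \<mu> j (int (part l i) - int (part \<mu> j) - int i + int j)" if "i \<le> N" for l i j
        using that by (simp add: c_def shifted_part_def of_nat_diff algebra_simps)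
      have det: "block_det 1 N (\<lambda>i j. c j (shifted_part N l i)) =
          block_det 1 N (\<lambda>i j. dual_coeff \<mu> j (int (part l i) - int (part \<mu> j) - int i + int j))" for l
        by (intro block_det_cong entry)
      have alternant: "schur_fin N l * vandermonde N = block_det 1 N (\<lambda>i j. xvar i ^ shifted_part N l j)"
        if "length l \<le> N" for l
        using schur_fin_eq(2) [OF that] by (simp add: shifted_part_def)
      have "mps_has_sum (\<lambda>l. ?f l * vandermonde N) ?I (set_zero_above N f * vandermonde N)"
        using fin by (rule mps_has_sum_times_right)
      \<comment> \<open>The index set changes without affecting the sum: partitions longer than
        \<open>N\<close> have vanishing Schur polynomial, and those of length at most
        \<open>N\<close> outside \<open>?I\<close> have vanishing coefficient determinant.\<close>
      then have "mps_has_sum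
        (\<lambda>l. mps_const (block_det 1 N (\<lambda>i j. c j (shifted_part N l i))) *
          block_det 1 N (\<lambda>i j. xvar i ^ shifted_part N l j))
        {l. is_partition l \<and> length l \<le> N} (set_zero_above N f * vandermonde N)"
      proof (rule mps_has_sum_cong_neutral)
        fix l assume l: "l \<in> ?I \<inter> {l. is_partition l \<and> length l \<le> N}"
        then have "block_det 1 N (\<lambda>i j. c j (shifted_part N l i)) = C l"
          unfolding det C_def using assms True by (intro dual_det_eq) auto
        then show "?f l * vandermonde N = mps_const (block_det 1 N (\<lambda>i j. c j (shifted_part N l i))) *
            block_det 1 N (\<lambda>i j. xvar i ^ shifted_part N l j)"
          using l alternant [of l] by (simp only: mult.assoc) simp
      next
        fix l assume "l \<in> ?I - {l. is_partition l \<and> length l \<le> N}"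
        then show "?f l * vandermonde N = 0" by (simp add: schur_fin_def)
      next
        fix l assume l: "l \<in> {l. is_partition l \<and> length l \<le> N} - ?I"
        then have "block_det 1 N (\<lambda>i j. c j (shifted_part N l i)) = 0"
          unfolding det using assms True by (intro dual_det_eq_0) auto
        then show "mps_const (block_det 1 N (\<lambda>i j. c j (shifted_part N l i))) *
            block_det 1 N (\<lambda>i j. xvar i ^ shifted_part N l j) = 0"
          by (intro mps_eqI) simp
      qed
      then have "set_zero_above N f * vandermonde N =
          block_det 1 N (\<lambda>i j. mps_univ (i - 1) (c j))"
        using alternant_expansion by (rule mps_has_sum_unique)
      also have "\<dots> = block_det 1 N (dual_schur_entry N \<mu>)"
        by (rule block_det_cong) (simp add: dual_schur_entry_eq c_def [abs_def])
      finally show ?thesis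
        using True by (simp add: dual_schur_fin_def exact_quot_eqI [OF nonzerodiv_vandermonde])
    qed
  qed
  then have "dual_schur \<mu> = f"
    unfolding dual_schur_def by (rule stable_limit_eqI)
  with f show ?thesis by (simp only: C_def)
qed

end
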